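(* Let $K$ be a field and $C\colon[0,\infty]\times[0,\infty)\to[0,\infty]$ a contour. Then $d_C$ is a pseudometric on $\mathrm{Tame}([0,\infty),\mathrm{Vec}_K)$.
   Context: A pseudometric on a collection $T$ is a function $d\colon T\times T\to[0,\infty]$ (the value $\infty$ is allowed) with $d(X,X)=0$, $d(X,Y)=d(Y,X)$ and $d(X,Y)+d(Y,Z)\geq d(X,Z)$. A $[0,\infty)$-parametrized $K$ vector space is a functor $V$ from the poset $[0,\infty)$ to $K$-vector spaces, with values $V_a$ and transition functions $V_{a\leq b}\colon V_a\to V_b$. It is tame if every $V_a$ is finite dimensional and there are finitely many $0<t_0<\cdots<t_k$ in $[0,\infty)$ such that, for $a\leq b$, $V_{a\leq b}$ may fail to be an isomorphism only if $a<t_i\leq b$ for some $i$. $\mathrm{Tame}([0,\infty),\mathrm{Vec}_K)$ is the category of tame $[0,\infty)$-parametrized $K$ vector spaces and natural transformations (maps). A contour is a function $C\colon[0,\infty]\times[0,\infty)\to[0,\infty]$ such that for all $a,b\in[0,\infty]$ and $\epsilon,\tau\in[0,\infty)$: (i) if $a\leq b$ and $\epsilon\leq\tau$ then $C(a,\epsilon)\leq C(b,\tau)$; (ii) $a\leq C(a,\epsilon)$; (iii) $C(C(a,\epsilon),\tau)\leq C(a,\epsilon+\tau)$. For $\epsilon\in[0,\infty)$, a map $f\colon V\to W$ of tame objects is an $\epsilon$-equivalence (with respect to $C$) if for every $a\in[0,\infty)$ with $C(a,\epsilon)<\infty$ there is a linear function $\beta\colon W_a\to V_{C(a,\epsilon)}$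 with $\beta f_a=V_{a\leq C(a,\epsilon)}$ and $f_{C(a,\epsilon)}\beta=W_{a\leq C(a,\epsilon)}$. Tame $V$ and $W$ are $\epsilon$-equivalent (with respect to $C$) if there are a tame $X$ and maps $f\colon V\to X$, $g\colon W\to X$ such that $f$ is an $\epsilon_1$-equivalence, $g$ is an $\epsilon_2$-equivalence and $\epsilon_1+\epsilon_2\leq\epsilon$. Define $d_C(V,W):=\inf\{\epsilon\in[0,\infty)\mid V\text{ and }W\text{ are }\epsilon\text{-equivalent}\}$, with $d_C(V,W):=\infty$ if this set is empty. *)

theory Defs
  imports "HOL-Library.Extended_Nonnegative_Real" "Jordan_Normal_Form.Missing_VectorSpace"
begin

text \<open>
  The parameter poset $[0,\infty)$ is rendered by the reals with guards \<open>0 \<le> a\<close>, the set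
  $[0,\infty]$ by \<^typ>\<open>ennreal\<close>.  Values of a parametrized vector space at negative
  parameters and of functions outside the carriers are irrelevant; no definition below looks
  at them.
\<close>

record ('k, 'v) parametrized =
  space_at :: "real \<Rightarrow> ('k, 'v) module"
  transition :: "real \<Rightarrow> real \<Rightarrow> 'v \<Rightarrow> 'v"

definition parametrized_vectorspace ::
    "('k, 'm) ring_scheme \<Rightarrow> ('k, 'v) parametrized \<Rightarrow> bool" where
  "parametrized_vectorspace K V \<longleftrightarrow>
     (\<forall>a\<ge>0. vectorspace K (space_at V a)) \<and>
     (\<forall>a b. 0 \<le> a \<and> a \<le> b \<longrightarrow>
        linear_map K (space_at V a) (space_at V b) (transition V a b)) \<and>
     (\<forall>a\<ge>0. \<forall>x\<in>carrier (space_at V a). transition V a a x = x) \<and>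
     (\<forall>a b c. 0 \<le> a \<and> a \<le> b \<and> b \<le> c \<longrightarrow>
        (\<forall>x\<in>carrier (space_at V a).
           transition V b c (transition V a b x) = transition V a c x))"

definition Tame :: "('k, 'm) ring_scheme \<Rightarrow> ('k, 'v) parametrized set" where
  "Tame K = {V. parametrized_vectorspace K V \<and>
     (\<forall>a\<ge>0. vectorspace.fin_dim K (space_at V a)) \<and>
     (\<exists>(k::nat) t. 0 < t 0 \<and> strict_mono_on {..k} t \<and>
        (\<forall>a b. 0 \<le> a \<and> a \<le> b \<and>
           \<not> bij_betw (transition V a b) (carrier (space_at V a)) (carrier (space_at V b)) \<longrightarrow>
           (\<exists>i\<le>k. a < t i \<and> t i \<le> b)))}"

definition natural_map ::
    "('k, 'm) ring_scheme \<Rightarrow> ('k, 'v) parametrized \<Rightarrow> ('k, 'w) parametrized \<Rightarrow>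
     (real \<Rightarrow> 'v \<Rightarrow> 'w) \<Rightarrow> bool" where
  "natural_map K V W f \<longleftrightarrow>
     (\<forall>a\<ge>0. linear_map K (space_at V a) (space_at W a) (f a)) \<and>
     (\<forall>a b. 0 \<le> a \<and> a \<le> b \<longrightarrow>
        (\<forall>x\<in>carrier (space_at V a). f b (transition V a b x) = transition W a b (f a x)))"

definition contour :: "(ennreal \<Rightarrow> real \<Rightarrow> ennreal) \<Rightarrow> bool" where
  "contour C \<longleftrightarrow>
     (\<forall>a b. \<forall>\<epsilon>\<ge>0. \<forall>\<tau>\<ge>0.
        (a \<le> b \<and> \<epsilon> \<le> \<tau> \<longrightarrow> C a \<epsilon> \<le> C b \<tau>) \<and>
        a \<le> C a \<epsilon> \<and>
        C (C a \<epsilon>) \<tau> \<le> C a (\<epsilon> + \<tau>))"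

definition eps_equivalence ::
    "('k, 'm) ring_scheme \<Rightarrow> (ennreal \<Rightarrow> real \<Rightarrow> ennreal) \<Rightarrow> real \<Rightarrow>
     ('k, 'v) parametrized \<Rightarrow> ('k, 'w) parametrized \<Rightarrow> (real \<Rightarrow> 'v \<Rightarrow> 'w) \<Rightarrow> bool" where
  "eps_equivalence K C \<epsilon> V W f \<longleftrightarrow> natural_map K V W f \<and>
     (\<forall>a\<ge>0. C (ennreal a) \<epsilon> < \<infinity> \<longrightarrow>
        (let c = enn2real (C (ennreal a) \<epsilon>) in
           \<exists>\<beta>. linear_map K (space_at W a) (space_at V c) \<beta> \<and>
             (\<forall>x\<in>carrier (space_at V a). \<beta> (f a x) = transition V a c x) \<and>
             (\<forall>y\<in>carrier (space_at W a). f c (\<beta> y) = transition W a c y)))"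

text \<open>
  The existentially quantified object \<open>X\<close> ranges over spaces with carriers in
  \<^typ>\<open>nat \<Rightarrow> 'k\<close>, independently of where \<open>V\<close> and \<open>W\<close> live.  Every finite dimensional
  space has an isomorphic copy there, so this is no restriction: \<open>eps_equivalentI\<close> below
  shows that an \<open>X\<close> over any type whatsoever will do.
\<close>

definition eps_equivalent ::
    "('k, 'm) ring_scheme \<Rightarrow> (ennreal \<Rightarrow> real \<Rightarrow> ennreal) \<Rightarrow> real \<Rightarrow>
     ('k, 'v) parametrized \<Rightarrow> ('k, 'w) parametrized \<Rightarrow> bool" where
  "eps_equivalent K C \<epsilon> V W \<longleftrightarrow>
     (\<exists>(X :: ('k, nat \<Rightarrow> 'k) parametrized) f g \<epsilon>1 \<epsilon>2.
        X \<in> Tame K \<and> 0 \<le> \<epsilon>1 \<and> 0 \<le> \<epsilon>2 \<and>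
        eps_equivalence K C \<epsilon>1 V X f \<and> eps_equivalence K C \<epsilon>2 W X g \<and>
        \<epsilon>1 + \<epsilon>2 \<le> \<epsilon>)"

text \<open>The infimum of the empty set in \<^typ>\<open>ennreal\<close> is \<open>\<infinity>\<close>.\<close>

definition contour_dist ::
    "('k, 'm) ring_scheme \<Rightarrow> (ennreal \<Rightarrow> real \<Rightarrow> ennreal) \<Rightarrow>
     ('k, 'v) parametrized \<Rightarrow> ('k, 'w) parametrized \<Rightarrow> ennreal" where
  "contour_dist K C V W = Inf {ennreal \<epsilon> | \<epsilon>. 0 \<le> \<epsilon> \<and> eps_equivalent K C \<epsilon> V W}"

definition pseudometric_on :: "'t set \<Rightarrow> ('t \<Rightarrow> 't \<Rightarrow> ennreal) \<Rightarrow> bool" where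
  "pseudometric_on T d \<longleftrightarrow>
     (\<forall>X\<in>T. d X X = 0) \<and>
     (\<forall>X\<in>T. \<forall>Y\<in>T. d X Y = d Y X) \<and>
     (\<forall>X\<in>T. \<forall>Y\<in>T. \<forall>Z\<in>T. d X Y + d Y Z \<ge> d X Z)"

subsection \<open>Independence of the type carrying the intermediate object\<close>

definition transport_vs :: "('v \<Rightarrow> 'w) \<Rightarrow> ('k, 'v) module \<Rightarrow> ('k, 'w) module" where
  "transport_vs h U =
     (let i = inv_into (carrier U) h in
      \<lparr>carrier = h ` carrier U, mult = (\<lambda>x y. x), one = h \<zero>\<^bsub>U\<^esub>, zero = h \<zero>\<^bsub>U\<^esub>,
       add = (\<lambda>x y. h (i x \<oplus>\<^bsub>U\<^esub> i y)), smult = (\<lambda>r x. h (r \<odot>\<^bsub>U\<^esub> i x))\<rparr>)"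

lemma transport_vs:
  assumes "vectorspace K U" and inj: "inj_on h (carrier U)"
  shows "vectorspace K (transport_vs h U)"
    and "linear_map K U (transport_vs h U) h"
    and "linear_map K (transport_vs h U) U (inv_into (carrier U) h)"
proof -
  interpret U: vectorspace K U by fact
  let ?T = "transport_vs h U"
  have [simp]: "carrier ?T = h ` carrier U" "\<zero>\<^bsub>?T\<^esub> = h \<zero>\<^bsub>U\<^esub>"
    by (simp_all add: transport_vs_def Let_def)
  have [simp]: "h x \<oplus>\<^bsub>?T\<^esub> h y = h (x \<oplus>\<^bsub>U\<^esub> y)" if "x \<in> carrier U" "y \<in> carrier U" for x y
    using that inj by (simp add: transport_vs_def Let_def)
  have [simp]: "r \<odot>\<^bsub>?T\<^esub> h x = h (r \<odot>\<^bsub>U\<^esub> x)" if "x \<in> carrier U" for r x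
    using that inj by (simp add: transport_vs_def Let_def)
  have neg: "\<exists>y\<in>carrier U. h (x \<oplus>\<^bsub>U\<^esub> y) = h \<zero>\<^bsub>U\<^esub>" if "x \<in> carrier U" for x
    using that by (intro bexI[of _ "\<ominus>\<^bsub>U\<^esub> x"]) (auto simp: U.r_neg)
  show T: "vectorspace K ?T"
    by (rule vs_criteria)
      (auto simp: neg U.a_ac U.smult_assoc1 U.smult_l_distr U.smult_r_distr
            intro: U.field_axioms)
  show "linear_map K U ?T h"
    unfolding linear_map_def mod_hom_def mod_hom_axioms_def module_hom_def
    using assms(1) T by (auto simp: vectorspace_def)
  show "linear_map K ?T U (inv_into (carrier U) h)"
    unfolding linear_map_def mod_hom_def mod_hom_axioms_def module_hom_def
    using assms(1) T inj by (auto simp: vectorspace_def)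
qed

lemma linear_map_comp:
  assumes "linear_map K U V f" "linear_map K V W g"
  shows "linear_map K U W (g \<circ> f)"
  using assms unfolding linear_map_def mod_hom_def mod_hom_axioms_def module_hom_def
  by (auto simp: Pi_def)

lemma fin_dim_inj_code:
  fixes K :: "('k, 'm) ring_scheme" and U :: "('k, 'v) module"
  assumes "vectorspace K U" "vectorspace.fin_dim K U"
  shows "\<exists>h :: 'v \<Rightarrow> nat \<Rightarrow> 'k. inj_on h (carrier U)"
proof -
  interpret U: vectorspace K U by fact
  obtain A where A: "finite A" "A \<subseteq> carrier U" "U.span A = carrier U"
    using assms(2) unfolding U.fin_dim_def by blast
  obtain n and e :: "nat \<Rightarrow> 'v" where e: "A = e ` {i. i < n}"
    using A(1) finite_imp_nat_seg_image_inj_on by blast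
  have "\<forall>x\<in>carrier U. \<exists>c. c \<in> A \<rightarrow> carrier K \<and> U.lincomb c A = x"
    using U.finite_in_span[OF A(1,2)] A(3) by blast
  then obtain c where c: "\<And>x. x \<in> carrier U \<Longrightarrow> c x \<in> A \<rightarrow> carrier K \<and> U.lincomb (c x) A = x"
    by metis
  have "inj_on (\<lambda>x i. c x (e i)) (carrier U)"
  proof (rule inj_onI)
    fix x y assume xy: "x \<in> carrier U" "y \<in> carrier U" "(\<lambda>i. c x (e i)) = (\<lambda>i. c y (e i))"
    have "c x v = c y v" if "v \<in> A" for v
      using that xy(3) unfolding e by (auto dest: fun_cong)
    then have "U.lincomb (c x) A = U.lincomb (c y) A"
      using U.lincomb_cong[OF refl A(2)] c xy by blast
    then show "x = y" using c xy by metis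
  qed
  then show ?thesis by blast
qed

definition transport_parametrized ::
    "(real \<Rightarrow> 'v \<Rightarrow> 'w) \<Rightarrow> ('k, 'v) parametrized \<Rightarrow> ('k, 'w) parametrized" where
  "transport_parametrized h X =
     \<lparr>space_at = (\<lambda>a. transport_vs (h a) (space_at X a)),
      transition = (\<lambda>a b. h b \<circ> transition X a b \<circ> inv_into (carrier (space_at X a)) (h a))\<rparr>"

context
  fixes K :: "('k, 'm) ring_scheme" and X :: "('k, 'v) parametrized" and h :: "real \<Rightarrow> 'v \<Rightarrow> 'w"
  assumes X: "X \<in> Tame K" and h: "\<And>a. 0 \<le> a \<Longrightarrow> inj_on (h a) (carrier (space_at X a))"
begin

private lemma vsX: "vectorspace K (space_at X a)" if "0 \<le> a" for a
  using X that by (simp add: Tame_def parametrized_vectorspace_def)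

private lemma trX: "linear_map K (space_at X a) (space_at X b) (transition X a b)"
  if "0 \<le> a" "a \<le> b" for a b
  using X that by (simp add: Tame_def parametrized_vectorspace_def)

private lemma trX_closed: "transition X a b x \<in> carrier (space_at X b)"
  if "0 \<le> a" "a \<le> b" "x \<in> carrier (space_at X a)" for a b x
  using mod_hom.f_im[OF linear_map.axioms(3)[OF trX[OF that(1,2)]]] that by blast

private lemma carr: "carrier (space_at (transport_parametrized h X) a) = h a ` carrier (space_at X a)"
  by (simp add: transport_parametrized_def transport_vs_def Let_def)

private lemma trT: "transition (transport_parametrized h X) a b (h a x) = h b (transition X a b x)"
  if "0 \<le> a" "x \<in> carrier (space_at X a)" for a b x
  using that h by (simp add: transport_parametrized_def)

private lemma trT_lin: "linear_map K (space_at (transport_parametrized h X) a)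
    (space_at (transport_parametrized h X) b) (transition (transport_parametrized h X) a b)"
  if "0 \<le> a" "a \<le> b" for a b
  using linear_map_comp[OF transport_vs(3)[OF vsX h]
      linear_map_comp[OF trX transport_vs(2)[OF vsX h]]] that
  by (simp add: transport_parametrized_def comp_assoc)

private lemma h_lin: "linear_map K (space_at X a) (space_at (transport_parametrized h X) a) (h a)"
  if "0 \<le> a" for a
  using transport_vs(2)[OF vsX h] that by (simp add: transport_parametrized_def)

private lemma inv_h_lin: "linear_map K (space_at (transport_parametrized h X) a) (space_at X a)
    (inv_into (carrier (space_at X a)) (h a))" if "0 \<le> a" for a
  using transport_vs(3)[OF vsX h] that by (simp add: transport_parametrized_def)

lemma transport_parametrized_Tame: "transport_parametrized h X \<in> Tame K"
proof -
  let ?T = "transport_parametrized h X"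
  have pv: "parametrized_vectorspace K ?T"
    unfolding parametrized_vectorspace_def
  proof (intro conjI allI impI ballI; (elim conjE)?)
    show "vectorspace K (space_at ?T a)" if "0 \<le> a" for a
      using transport_vs(1)[OF vsX h] that by (simp add: transport_parametrized_def)
    show "linear_map K (space_at ?T a) (space_at ?T b) (transition ?T a b)"
      if "0 \<le> a" "a \<le> b" for a b using trT_lin that .
    show "transition ?T a a x = x" if "0 \<le> a" "x \<in> carrier (space_at ?T a)" for a x
      using that X by (auto simp: carr trT Tame_def parametrized_vectorspace_def)
    show "transition ?T b c (transition ?T a b x) = transition ?T a c x"
      if x: "x \<in> carrier (space_at ?T a)" and le: "0 \<le> a" "a \<le> b" "b \<le> c" for a b c x
    proof -
      obtain y where y: "x = h a y" "y \<in> carrier (space_at X a)"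
        using x by (auto simp: carr)
      have "transition X b c (transition X a b y) = transition X a c y"
        using X le y by (simp add: Tame_def parametrized_vectorspace_def)
      then show ?thesis
        using le y by (simp add: trT trX_closed)
    qed
  qed
  have fd: "vectorspace.fin_dim K (space_at ?T a)" if "0 \<le> a" for a
  proof -
    interpret L: linear_map K "space_at X a" "space_at ?T a" "h a" using h_lin that .
    have "vectorspace.fin_dim K (space_at X a)" using X that by (simp add: Tame_def)
    then show "vectorspace.fin_dim K (space_at ?T a)" using L.rank_nullity_main(2) by (simp add: carr)
  qed
  have bij: "bij_betw (transition ?T a b) (carrier (space_at ?T a)) (carrier (space_at ?T b))"
    if ab: "0 \<le> a" "a \<le> b"
      and "bij_betw (transition X a b) (carrier (space_at X a)) (carrier (space_at X b))" for a b
  proof -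
    have 1: "bij_betw (inv_into (carrier (space_at X a)) (h a)) (h a ` carrier (space_at X a))
        (carrier (space_at X a))"
      by (rule bij_betw_inv_into) (use ab h in \<open>auto simp: bij_betw_def\<close>)
    have 2: "bij_betw (h b) (carrier (space_at X b)) (h b ` carrier (space_at X b))"
      using ab h by (auto simp: bij_betw_def)
    show ?thesis
      unfolding carr using bij_betw_trans[OF 1 bij_betw_trans[OF that(3) 2]]
      by (simp add: transport_parametrized_def comp_assoc)
  qed
  obtain k :: nat and t where t: "0 < t 0" "strict_mono_on {..k} t"
    "\<forall>a b. 0 \<le> a \<and> a \<le> b \<and>
       \<not> bij_betw (transition X a b) (carrier (space_at X a)) (carrier (space_at X b)) \<longrightarrow>
       (\<exists>i\<le>k. a < t i \<and> t i \<le> b)"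
    using X unfolding Tame_def by blast
  have "\<forall>a b. 0 \<le> a \<and> a \<le> b \<and>
       \<not> bij_betw (transition ?T a b) (carrier (space_at ?T a)) (carrier (space_at ?T b)) \<longrightarrow>
       (\<exists>i\<le>k. a < t i \<and> t i \<le> b)"
    using t(3) bij by meson
  then show ?thesis
    unfolding Tame_def using pv fd t(1,2) by blast
qed

lemma transport_eps_equivalence:
  assumes f: "eps_equivalence K C \<epsilon> V X f" and le: "\<And>a. a \<le> C a \<epsilon>"
  shows "eps_equivalence K C \<epsilon> V (transport_parametrized h X) (\<lambda>a. h a \<circ> f a)"
proof -
  let ?T = "transport_parametrized h X"
  have nat: "natural_map K V X f" using f by (simp add: eps_equivalence_def)
  have f_lin: "linear_map K (space_at V a) (space_at X a) (f a)" if "0 \<le> a" for a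
    using nat that by (simp add: natural_map_def)
  have fc: "f a x \<in> carrier (space_at X a)" if "0 \<le> a" "x \<in> carrier (space_at V a)" for a x
    using mod_hom.f_im[OF linear_map.axioms(3)[OF f_lin[OF that(1)]]] that by blast
  show ?thesis
    unfolding eps_equivalence_def natural_map_def Let_def
  proof (intro conjI allI impI ballI; (elim conjE)?)
    show "linear_map K (space_at V a) (space_at ?T a) (h a \<circ> f a)" if "0 \<le> a" for a
      using linear_map_comp[OF f_lin[OF that] h_lin[OF that]] .
    show "(h b \<circ> f b) (transition V a b x) = transition ?T a b ((h a \<circ> f a) x)"
      if "x \<in> carrier (space_at V a)" "0 \<le> a" "a \<le> b" for a b x
      using nat that fc by (simp add: trT natural_map_def)
    fix a :: real assume a: "0 \<le> a" "C (ennreal a) \<epsilon> < \<infinity>"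
    define c where "c = enn2real (C (ennreal a) \<epsilon>)"
    have "ennreal a \<le> ennreal c"
      using a le[of "ennreal a"] unfolding c_def by (simp add: less_top)
    then have c: "0 \<le> c" "a \<le> c" using a by (auto simp: c_def)
    obtain \<beta> where \<beta>: "linear_map K (space_at X a) (space_at V c) \<beta>"
      "\<And>x. x \<in> carrier (space_at V a) \<Longrightarrow> \<beta> (f a x) = transition V a c x"
      "\<And>y. y \<in> carrier (space_at X a) \<Longrightarrow> f c (\<beta> y) = transition X a c y"
      using f a unfolding eps_equivalence_def c_def Let_def by blast
    let ?\<beta> = "\<beta> \<circ> inv_into (carrier (space_at X a)) (h a)"
    have "linear_map K (space_at ?T a) (space_at V c) ?\<beta>"
      using linear_map_comp[OF inv_h_lin[OF a(1)] \<beta>(1)] .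
    moreover have "\<forall>x\<in>carrier (space_at V a). ?\<beta> ((h a \<circ> f a) x) = transition V a c x"
      using a \<beta>(2) h fc by simp
    moreover have "\<forall>y\<in>carrier (space_at ?T a). (h c \<circ> f c) (?\<beta> y) = transition ?T a c y"
      using a \<beta>(3) h by (auto simp: carr trT)
    ultimately show "\<exists>\<beta>. linear_map K (space_at ?T a)
          (space_at V (enn2real (C (ennreal a) \<epsilon>))) \<beta> \<and>
        (\<forall>x\<in>carrier (space_at V a). \<beta> ((h a \<circ> f a) x) =
           transition V a (enn2real (C (ennreal a) \<epsilon>)) x) \<and>
        (\<forall>y\<in>carrier (space_at ?T a). (h (enn2real (C (ennreal a) \<epsilon>)) \<circ>
           f (enn2real (C (ennreal a) \<epsilon>))) (\<beta> y) =
           transition ?T a (enn2real (C (ennreal a) \<epsilon>)) y)"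
      unfolding c_def by blast
  qed
qed

end

lemma eps_equivalentI:
  fixes X :: "('k, 'x) parametrized"
  assumes C: "contour C" and X: "X \<in> Tame K" and \<epsilon>: "0 \<le> \<epsilon>1" "0 \<le> \<epsilon>2" "\<epsilon>1 + \<epsilon>2 \<le> \<epsilon>"
    and f: "eps_equivalence K C \<epsilon>1 V X f" and g: "eps_equivalence K C \<epsilon>2 W X g"
  shows "eps_equivalent K C \<epsilon> V W"
proof -
  have ex: "\<exists>h :: 'x \<Rightarrow> nat \<Rightarrow> 'k. inj_on h (carrier (space_at X a))" if "0 \<le> a" for a
    by (rule fin_dim_inj_code[of K])
      (use X that in \<open>simp_all add: Tame_def parametrized_vectorspace_def\<close>)
  define h where "h a = (SOME h :: 'x \<Rightarrow> nat \<Rightarrow> 'k. inj_on h (carrier (space_at X a)))" for a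
  have h: "inj_on (h a) (carrier (space_at X a))" if "0 \<le> a" for a
    unfolding h_def by (rule someI_ex[OF ex[OF that]])
  have le: "a \<le> C a \<delta>" if "0 \<le> \<delta>" for a \<delta>
    using C that unfolding contour_def by blast
  show ?thesis
    unfolding eps_equivalent_def
    using transport_parametrized_Tame[OF X h] \<epsilon>
      transport_eps_equivalence[OF X h f le[OF \<epsilon>(1)]]
      transport_eps_equivalence[OF X h g le[OF \<epsilon>(2)]]
    by blast
qed

end

theory Submission
  imports Defs
begin

text \<open>
  Reflexivity and symmetry of $\epsilon$-equivalence are immediate.  For the triangle inequality,
  let \<open>V \<rightarrow> X \<leftarrow> W\<close> and \<open>W \<rightarrow> Y \<leftarrow> Z\<close> witness an $\epsilon$- and a $\delta$-equivalence, and let \<open>P\<close> be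
  the pushout of \<open>X \<leftarrow> W \<rightarrow> Y\<close>, formed at each parameter; it is again tame.  The cobase change of
  an $\epsilon$-equivalence along any map is an $\epsilon$-equivalence, and by the third contour axiom
  an $\epsilon$-equivalence followed by a $\tau$-equivalence is an $(\epsilon+\tau)$-equivalence.
  Hence \<open>V \<rightarrow> P \<leftarrow> Z\<close> witnesses that \<open>V\<close> and \<open>Z\<close> are $(\epsilon+\delta)$-equivalent.
\<close>

section \<open>Linear maps and quotients of vector spaces\<close>

lemma linear_mapI:
  assumes "vectorspace K U" "vectorspace K V"
    and "\<And>x. x \<in> carrier U \<Longrightarrow> f x \<in> carrier V"
    and "\<And>x y. \<lbrakk>x \<in> carrier U; y \<in> carrier U\<rbrakk> \<Longrightarrow> f (x \<oplus>\<^bsub>U\<^esub> y) = f x \<oplus>\<^bsub>V\<^esub> f y"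
    and "\<And>r x. \<lbrakk>r \<in> carrier K; x \<in> carrier U\<rbrakk> \<Longrightarrow> f (r \<odot>\<^bsub>U\<^esub> x) = r \<odot>\<^bsub>V\<^esub> f x"
  shows "linear_map K U V f"
  unfolding linear_map_def mod_hom_def mod_hom_axioms_def module_hom_def
  using assms by (auto simp: vectorspace_def)

lemma linear_mapD:
  assumes "linear_map K U V f"
  shows "vectorspace K U" "vectorspace K V"
    and "x \<in> carrier U \<Longrightarrow> f x \<in> carrier V"
    and "\<lbrakk>x \<in> carrier U; y \<in> carrier U\<rbrakk> \<Longrightarrow> f (x \<oplus>\<^bsub>U\<^esub> y) = f x \<oplus>\<^bsub>V\<^esub> f y"
    and "\<lbrakk>r \<in> carrier K; x \<in> carrier U\<rbrakk> \<Longrightarrow> f (r \<odot>\<^bsub>U\<^esub> x) = r \<odot>\<^bsub>V\<^esub> f x"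
  using assms unfolding linear_map_def mod_hom_def mod_hom_axioms_def module_hom_def
  by auto

text \<open>Applied to a map \<open>q\<close> that is not injective, \<^const>\<open>transport_vs\<close> yields the quotient by
  the fibres of \<open>q\<close>, provided that these form a congruence.\<close>

lemma transport_vs_congruence:
  assumes "vectorspace K U"
    and add: "\<And>x x' y y'. \<lbrakk>x \<in> carrier U; x' \<in> carrier U; y \<in> carrier U; y' \<in> carrier U;
        q x = q x'; q y = q y'\<rbrakk> \<Longrightarrow> q (x \<oplus>\<^bsub>U\<^esub> y) = q (x' \<oplus>\<^bsub>U\<^esub> y')"
    and smult: "\<And>r x x'. \<lbrakk>r \<in> carrier K; x \<in> carrier U; x' \<in> carrier U; q x = q x'\<rbrakk>
        \<Longrightarrow> q (r \<odot>\<^bsub>U\<^esub> x) = q (r \<odot>\<^bsub>U\<^esub> x')"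
  shows "linear_map K U (transport_vs q U) q"
proof -
  interpret U: vectorspace K U by fact
  let ?T = "transport_vs q U"
  have [simp]: "carrier ?T = q ` carrier U" "\<zero>\<^bsub>?T\<^esub> = q \<zero>\<^bsub>U\<^esub>"
    by (simp_all add: transport_vs_def Let_def)
  have inv: "inv_into (carrier U) q (q x) \<in> carrier U"
      "q (inv_into (carrier U) q (q x)) = q x" if "x \<in> carrier U" for x
    using that by (simp_all add: inv_into_into f_inv_into_f)
  \<comment> \<open>The operations of \<open>?T\<close> use the representatives chosen by
    \<open>inv_into\<close>; the congruence hypotheses exchange them for the given ones.\<close>
  have [simp]: "q x \<oplus>\<^bsub>?T\<^esub> q y = q (x \<oplus>\<^bsub>U\<^esub> y)" if "x \<in> carrier U" "y \<in> carrier U" for x y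
    using add[of "inv_into (carrier U) q (q x)" x "inv_into (carrier U) q (q y)" y] that
    by (simp add: transport_vs_def Let_def inv)
  have [simp]: "r \<odot>\<^bsub>?T\<^esub> q x = q (r \<odot>\<^bsub>U\<^esub> x)" if "r \<in> carrier K" "x \<in> carrier U" for r x
    using smult[of r "inv_into (carrier U) q (q x)" x] that
    by (simp add: transport_vs_def Let_def inv)
  have neg: "\<exists>y\<in>carrier U. q (x \<oplus>\<^bsub>U\<^esub> y) = q \<zero>\<^bsub>U\<^esub>" if "x \<in> carrier U" for x
    using that by (intro bexI[of _ "\<ominus>\<^bsub>U\<^esub> x"]) (auto simp: U.r_neg)
  have T: "vectorspace K ?T"
    by (rule vs_criteria)
      (auto simp: neg U.a_ac U.smult_assoc1 U.smult_l_distr U.smult_r_distr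
            intro: U.field_axioms)
  show ?thesis
    by (rule linear_mapI) (use assms(1) T in auto)
qed

section \<open>The pushout of vector spaces\<close>

lemma direct_sum_simps:
  "carrier (direct_sum X Y) = carrier X \<times> carrier Y"
  "p \<oplus>\<^bsub>direct_sum X Y\<^esub> p' = (fst p \<oplus>\<^bsub>X\<^esub> fst p', snd p \<oplus>\<^bsub>Y\<^esub> snd p')"
  "r \<odot>\<^bsub>direct_sum X Y\<^esub> p = (r \<odot>\<^bsub>X\<^esub> fst p, r \<odot>\<^bsub>Y\<^esub> snd p)"
  by (simp_all add: direct_sum_def)

text \<open>For linear \<open>g\<close> and \<open>h\<close> this is the coset of \<open>p\<close>
  modulo the subspace of all pairs (g w, - h w), so that (g w, 0) and (0, h w) become equal. The
  second component is moved to the other side to avoid subtraction.\<close>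

definition pushout_class ::
    "('k, 'w) module \<Rightarrow> ('k, 'x) module \<Rightarrow> ('k, 'y) module \<Rightarrow> ('w \<Rightarrow> 'x) \<Rightarrow> ('w \<Rightarrow> 'y) \<Rightarrow>
     'x \<times> 'y \<Rightarrow> ('x \<times> 'y) set" where
  "pushout_class W X Y g h p =
     {p' \<in> carrier X \<times> carrier Y. \<exists>w\<in>carrier W.
        fst p' = fst p \<oplus>\<^bsub>X\<^esub> g w \<and> snd p = snd p' \<oplus>\<^bsub>Y\<^esub> h w}"

text \<open>As \<open>pushout_class\<close> is in general not injective, the transported space is a
  quotient of the direct sum.\<close>

definition pushout_vs ::
    "('k, 'w) module \<Rightarrow> ('k, 'x) module \<Rightarrow> ('k, 'y) module \<Rightarrow> ('w \<Rightarrow> 'x) \<Rightarrow> ('w \<Rightarrow> 'y) \<Rightarrow>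
     ('k, ('x \<times> 'y) set) module" where
  "pushout_vs W X Y g h = transport_vs (pushout_class W X Y g h) (direct_sum X Y)"

definition pushout_in1 ::
    "('k, 'w) module \<Rightarrow> ('k, 'x) module \<Rightarrow> ('k, 'y) module \<Rightarrow> ('w \<Rightarrow> 'x) \<Rightarrow> ('w \<Rightarrow> 'y) \<Rightarrow>
     'x \<Rightarrow> ('x \<times> 'y) set" where
  "pushout_in1 W X Y g h x = pushout_class W X Y g h (x, \<zero>\<^bsub>Y\<^esub>)"

definition pushout_in2 ::
    "('k, 'w) module \<Rightarrow> ('k, 'x) module \<Rightarrow> ('k, 'y) module \<Rightarrow> ('w \<Rightarrow> 'x) \<Rightarrow> ('w \<Rightarrow> 'y) \<Rightarrow>
     'y \<Rightarrow> ('x \<times> 'y) set" where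
  "pushout_in2 W X Y g h y = pushout_class W X Y g h (\<zero>\<^bsub>X\<^esub>, y)"

text \<open>The map out of the pushout induced by \<open>u\<close> and \<open>v\<close>, evaluated
  on a representative picked by \<open>inv_into\<close>. The choice is immaterial once
  \<open>u\<close> after \<open>g\<close> agrees with \<open>v\<close> after \<open>h\<close>; see
  \<open>lift_q\<close>.\<close>

definition pushout_lift ::
    "('k, 'w) module \<Rightarrow> ('k, 'x) module \<Rightarrow> ('k, 'y) module \<Rightarrow> ('w \<Rightarrow> 'x) \<Rightarrow> ('w \<Rightarrow> 'y) \<Rightarrow>
     ('k, 't) module \<Rightarrow> ('x \<Rightarrow> 't) \<Rightarrow> ('y \<Rightarrow> 't) \<Rightarrow> ('x \<times> 'y) set \<Rightarrow> 't" where
  "pushout_lift W X Y g h T u v P =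
     (let p = inv_into (carrier X \<times> carrier Y) (pushout_class W X Y g h) P
      in u (fst p) \<oplus>\<^bsub>T\<^esub> v (snd p))"

text \<open>A span in the sense of category theory, a diagram X <- W -> Y, as opposed to the linear
  hull \<open>X.span\<close>.\<close>

locale linear_span = W: vectorspace K W + X: vectorspace K X + Y: vectorspace K Y
  for K :: "('k, 'm) ring_scheme" and W :: "('k, 'w) module" and X :: "('k, 'x) module"
    and Y :: "('k, 'y) module" +
  fixes g :: "'w \<Rightarrow> 'x" and h :: "'w \<Rightarrow> 'y"
  assumes g: "linear_map K W X g" and h: "linear_map K W Y h"
begin

abbreviation "q \<equiv> pushout_class W X Y g h"
abbreviation "P \<equiv> pushout_vs W X Y g h"
abbreviation "in1 \<equiv> pushout_in1 W X Y g h"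
abbreviation "in2 \<equiv> pushout_in2 W X Y g h"
abbreviation "lift \<equiv> pushout_lift W X Y g h"

lemmas g_simps = linear_mapD(3-5)[OF g]
lemmas h_simps = linear_mapD(3-5)[OF h]

lemma g_zero: "g \<zero>\<^bsub>W\<^esub> = \<zero>\<^bsub>X\<^esub>" and h_zero: "h \<zero>\<^bsub>W\<^esub> = \<zero>\<^bsub>Y\<^esub>"
proof -
  interpret G: linear_map K W X g by (rule g)
  interpret H: linear_map K W Y h by (rule h)
  show "g \<zero>\<^bsub>W\<^esub> = \<zero>\<^bsub>X\<^esub>" "h \<zero>\<^bsub>W\<^esub> = \<zero>\<^bsub>Y\<^esub>" by simp_all
qed

text \<open>Displacements add: a step by \<open>w\<close> followed by a step by \<open>v\<close> is
  a step by their sum. The reverse inclusion is the same statement for the negative of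
  \<open>w\<close>.\<close>

lemma pushout_class_trans:
  assumes xy: "x \<in> carrier X" "x' \<in> carrier X" "y \<in> carrier Y" "y' \<in> carrier Y"
    and w: "w \<in> carrier W" "x' = x \<oplus>\<^bsub>X\<^esub> g w" "y = y' \<oplus>\<^bsub>Y\<^esub> h w"
  shows "q (x', y') \<subseteq> q (x, y)"
proof
  fix p assume "p \<in> q (x', y')"
  then obtain v where v: "v \<in> carrier W" "p \<in> carrier X \<times> carrier Y"
    "fst p = x' \<oplus>\<^bsub>X\<^esub> g v" "y' = snd p \<oplus>\<^bsub>Y\<^esub> h v"
    by (auto simp: pushout_class_def)
  have "fst p = x \<oplus>\<^bsub>X\<^esub> g (v \<oplus>\<^bsub>W\<^esub> w)" "y = snd p \<oplus>\<^bsub>Y\<^esub> h (v \<oplus>\<^bsub>W\<^esub> w)"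
    using v w xy by (auto simp: g_simps h_simps X.a_ac Y.a_ac)
  then show "p \<in> q (x, y)"
    using v w by (auto simp: pushout_class_def)
qed

lemma pushout_class_eq_iff:
  assumes xy: "x \<in> carrier X" "x' \<in> carrier X" "y \<in> carrier Y" "y' \<in> carrier Y"
  shows "q (x, y) = q (x', y') \<longleftrightarrow> (\<exists>w\<in>carrier W. x' = x \<oplus>\<^bsub>X\<^esub> g w \<and> y = y' \<oplus>\<^bsub>Y\<^esub> h w)"
proof
  have "(x', y') \<in> q (x', y')"
    using xy by (auto simp: pushout_class_def g_zero h_zero intro!: bexI[of _ "\<zero>\<^bsub>W\<^esub>"])
  moreover assume "q (x, y) = q (x', y')"
  ultimately have "(x', y') \<in> q (x, y)" by simp
  then show "\<exists>w\<in>carrier W. x' = x \<oplus>\<^bsub>X\<^esub> g w \<and> y = y' \<oplus>\<^bsub>Y\<^esub> h w"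
    by (auto simp: pushout_class_def)
next
  assume "\<exists>w\<in>carrier W. x' = x \<oplus>\<^bsub>X\<^esub> g w \<and> y = y' \<oplus>\<^bsub>Y\<^esub> h w"
  then obtain w where w: "w \<in> carrier W" "x' = x \<oplus>\<^bsub>X\<^esub> g w" "y = y' \<oplus>\<^bsub>Y\<^esub> h w" by blast
  \<comment> \<open>Negating the witness reverses the step, which gives the second
    inclusion.\<close>
  have "g w \<oplus>\<^bsub>X\<^esub> g (\<ominus>\<^bsub>W\<^esub> w) = \<zero>\<^bsub>X\<^esub>" "h w \<oplus>\<^bsub>Y\<^esub> h (\<ominus>\<^bsub>W\<^esub> w) = \<zero>\<^bsub>Y\<^esub>"
    using w g_simps(2)[of w "\<ominus>\<^bsub>W\<^esub> w"] h_simps(2)[of w "\<ominus>\<^bsub>W\<^esub> w"]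
    by (simp_all add: W.r_neg g_zero h_zero)
  then have "x = x' \<oplus>\<^bsub>X\<^esub> g (\<ominus>\<^bsub>W\<^esub> w)" "y' = y \<oplus>\<^bsub>Y\<^esub> h (\<ominus>\<^bsub>W\<^esub> w)"
    using w xy by (simp_all add: X.a_assoc Y.a_assoc g_simps h_simps)
  with w show "q (x, y) = q (x', y')"
    using pushout_class_trans[OF xy w]
      pushout_class_trans[OF xy(2,1,4,3), of "\<ominus>\<^bsub>W\<^esub> w"] by auto
qed

lemma pushout_class_eqI:
  assumes "x \<in> carrier X" "x' \<in> carrier X" "y \<in> carrier Y" "y' \<in> carrier Y"
    and "w \<in> carrier W" "x' = x \<oplus>\<^bsub>X\<^esub> g w" "y = y' \<oplus>\<^bsub>Y\<^esub> h w"
  shows "q (x, y) = q (x', y')"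
  using assms by (metis pushout_class_eq_iff)

text \<open>Equality of classes is witnessed by elements of \<open>W\<close>, and witnesses add and
  scale along with the pairs; hence the fibres of \<open>q\<close> form a congruence.\<close>

lemma q_linear: "linear_map K (direct_sum X Y) P q"
  unfolding pushout_vs_def
proof (rule transport_vs_congruence)
  show "vectorspace K (direct_sum X Y)"
    by (rule direct_sum_is_vs) unfold_locales
next
  fix p p' s s'
  assume "p \<in> carrier (direct_sum X Y)" "p' \<in> carrier (direct_sum X Y)"
    "s \<in> carrier (direct_sum X Y)" "s' \<in> carrier (direct_sum X Y)"
  then obtain x y x' y' u v u' v'
    where eqs: "p = (x, y)" "p' = (x', y')" "s = (u, v)" "s' = (u', v')"
    and c: "x \<in> carrier X" "x' \<in> carrier X" "u \<in> carrier X" "u' \<in> carrier X"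
     "y \<in> carrier Y" "y' \<in> carrier Y" "v \<in> carrier Y" "v' \<in> carrier Y"
    by (auto simp: direct_sum_simps)
  assume "q p = q p'" "q s = q s'"
  then obtain w z where w: "w \<in> carrier W" "x' = x \<oplus>\<^bsub>X\<^esub> g w" "y = y' \<oplus>\<^bsub>Y\<^esub> h w"
    and z: "z \<in> carrier W" "u' = u \<oplus>\<^bsub>X\<^esub> g z" "v = v' \<oplus>\<^bsub>Y\<^esub> h z"
    using c by (auto simp: eqs pushout_class_eq_iff)
  have "x' \<oplus>\<^bsub>X\<^esub> u' = x \<oplus>\<^bsub>X\<^esub> u \<oplus>\<^bsub>X\<^esub> g (w \<oplus>\<^bsub>W\<^esub> z)" "y \<oplus>\<^bsub>Y\<^esub> v = y' \<oplus>\<^bsub>Y\<^esub> v' \<oplus>\<^bsub>Y\<^esub> h (w \<oplus>\<^bsub>W\<^esub> z)"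
    using c w z by (simp_all add: g_simps h_simps X.a_ac Y.a_ac)
  then show "q (p \<oplus>\<^bsub>direct_sum X Y\<^esub> s) = q (p' \<oplus>\<^bsub>direct_sum X Y\<^esub> s')"
    unfolding eqs direct_sum_simps fst_conv snd_conv
    using c w(1) z(1) by (intro pushout_class_eqI[of _ _ _ _ "w \<oplus>\<^bsub>W\<^esub> z"]) (auto simp: g_simps(1) h_simps(1))
next
  fix r p p'
  assume r: "r \<in> carrier K"
    and "p \<in> carrier (direct_sum X Y)" "p' \<in> carrier (direct_sum X Y)"
  then obtain x y x' y' where eqs: "p = (x, y)" "p' = (x', y')"
    and c: "x \<in> carrier X" "x' \<in> carrier X" "y \<in> carrier Y" "y' \<in> carrier Y"
    by (auto simp: direct_sum_simps)
  assume "q p = q p'"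
  then obtain w where w: "w \<in> carrier W" "x' = x \<oplus>\<^bsub>X\<^esub> g w" "y = y' \<oplus>\<^bsub>Y\<^esub> h w"
    using c by (auto simp: eqs pushout_class_eq_iff)
  then have "r \<odot>\<^bsub>X\<^esub> x' = r \<odot>\<^bsub>X\<^esub> x \<oplus>\<^bsub>X\<^esub> g (r \<odot>\<^bsub>W\<^esub> w)" "r \<odot>\<^bsub>Y\<^esub> y = r \<odot>\<^bsub>Y\<^esub> y' \<oplus>\<^bsub>Y\<^esub> h (r \<odot>\<^bsub>W\<^esub> w)"
    using r c by (simp_all add: g_simps h_simps X.smult_r_distr Y.smult_r_distr)
  then show "q (r \<odot>\<^bsub>direct_sum X Y\<^esub> p) = q (r \<odot>\<^bsub>direct_sum X Y\<^esub> p')"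
    unfolding eqs direct_sum_simps fst_conv snd_conv
    using r c w(1) by (intro pushout_class_eqI[of _ _ _ _ "r \<odot>\<^bsub>W\<^esub> w"]) (auto simp: g_simps(1) h_simps(1))
qed

lemma vs_pushout: "vectorspace K P"
  using linear_mapD(2)[OF q_linear] .

lemma carrier_pushout: "carrier P = q ` (carrier X \<times> carrier Y)"
  by (simp add: pushout_vs_def transport_vs_def Let_def direct_sum_simps)

lemma in1_linear: "linear_map K X P in1"
  using linear_map_comp[OF inj1_linear[of K X Y] q_linear] X.vectorspace_axioms Y.vectorspace_axioms
  by (simp add: inj1_def comp_def pushout_in1_def[abs_def])

lemma in2_linear: "linear_map K Y P in2"
  using linear_map_comp[OF inj2_linear[of K X Y] q_linear] X.vectorspace_axioms Y.vectorspace_axioms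
  by (simp add: inj2_def comp_def pushout_in2_def[abs_def])

lemma in1_g_eq_in2_h: "in1 (g w) = in2 (h w)" if "w \<in> carrier W"
proof -
  \<comment> \<open>The class relation moves (0, h w) to (g w, 0) by \<open>w\<close> itself; in the
    opposite orientation the witness would be the negative of \<open>w\<close>.\<close>
  have "in2 (h w) = in1 (g w)"
    using that unfolding pushout_in1_def pushout_in2_def
    by (subst pushout_class_eq_iff) (auto simp: g_simps h_simps)
  then show ?thesis by simp
qed

lemma q_eq_sum: "q (x, y) = in1 x \<oplus>\<^bsub>P\<^esub> in2 y" if "x \<in> carrier X" "y \<in> carrier Y"
  using that linear_mapD(4)[OF q_linear, of "(x, \<zero>\<^bsub>Y\<^esub>)" "(\<zero>\<^bsub>X\<^esub>, y)"]
  by (simp add: direct_sum_simps pushout_in1_def pushout_in2_def)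

lemma pushout_cases:
  assumes "p \<in> carrier P"
  obtains x y where "x \<in> carrier X" "y \<in> carrier Y" "p = in1 x \<oplus>\<^bsub>P\<^esub> in2 y"
  using assms by (auto simp: carrier_pushout q_eq_sum)

text \<open>The uniqueness half of the universal property: the images of \<open>in1\<close> and
  \<open>in2\<close> together generate the pushout.\<close>

lemma pushout_hom_eqI:
  assumes \<phi>: "linear_map K P T \<phi>" and \<psi>: "linear_map K P T \<psi>"
    and "\<And>x. x \<in> carrier X \<Longrightarrow> \<phi> (in1 x) = \<psi> (in1 x)"
    and "\<And>y. y \<in> carrier Y \<Longrightarrow> \<phi> (in2 y) = \<psi> (in2 y)"
    and "p \<in> carrier P"
  shows "\<phi> p = \<psi> p"
proof -
  obtain x y where xy: "x \<in> carrier X" "y \<in> carrier Y" "p = in1 x \<oplus>\<^bsub>P\<^esub> in2 y"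
    using pushout_cases[OF assms(5)] .
  then have "in1 x \<in> carrier P" "in2 y \<in> carrier P"
    using linear_mapD(3)[OF in1_linear] linear_mapD(3)[OF in2_linear] by auto
  then show ?thesis
    using xy assms(3,4) by (simp add: linear_mapD(4)[OF \<phi>] linear_mapD(4)[OF \<psi>])
qed

text \<open>Finite spanning sets of \<open>X\<close> and \<open>Y\<close> are pushed forward by
  \<open>in1\<close> and \<open>in2\<close>, and the union of their images spans.\<close>

lemma fin_dim_pushout:
  assumes "X.fin_dim" "Y.fin_dim"
  shows "vectorspace.fin_dim K P"
proof -
  interpret P: vectorspace K P by (rule vs_pushout)
  \<comment> \<open>A linear map that sends a spanning set into a submodule sends the whole space
    there, since the preimage of a submodule is a submodule.\<close>
  have im: "f ` carrier U \<subseteq> N"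
    if f: "linear_map K U P f" and N: "submodule K N P" and A: "A \<subseteq> carrier U" "f ` A \<subseteq> N"
      "module.span K U A = carrier U" for U :: "('k, 'u) module" and f N A
  proof -
    interpret U: vectorspace K U using linear_mapD(1)[OF f] .
    interpret F: linear_map K U P f by (rule f)
    interpret N: submodule K N P by (rule N)
    have "submodule K {x \<in> carrier U. f x \<in> N} U"
      by (rule submodule.intro) (use U.module_axioms N.m_closed N.smult_closed in auto)
    from U.span_is_subset[OF _ this, of A] A show ?thesis by auto
  qed
  obtain A B where A: "finite A" "A \<subseteq> carrier X" "X.span A = carrier X"
    and B: "finite B" "B \<subseteq> carrier Y" "Y.span B = carrier Y"
    using assms unfolding X.fin_dim_def Y.fin_dim_def by blast
  let ?G = "in1 ` A \<union> in2 ` B"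
  have G: "?G \<subseteq> carrier P"
    using A B linear_mapD(3)[OF in1_linear] linear_mapD(3)[OF in2_linear] by blast
  have N: "submodule K (P.span ?G) P" by (rule P.span_is_submodule[OF G])
  have sub: "?G \<subseteq> P.span ?G" by (rule P.in_own_span[OF G])
  have 1: "in1 ` carrier X \<subseteq> P.span ?G"
    by (rule im[OF in1_linear N A(2) _ A(3)]) (use sub in blast)
  have 2: "in2 ` carrier Y \<subseteq> P.span ?G"
    by (rule im[OF in2_linear N B(2) _ B(3)]) (use sub in blast)
  have "p \<in> P.span ?G" if p: "p \<in> carrier P" for p
  proof -
    obtain x y where xy: "x \<in> carrier X" "y \<in> carrier Y" "p = in1 x \<oplus>\<^bsub>P\<^esub> in2 y"
      using pushout_cases[OF p] .
    show ?thesis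
      unfolding xy(3) by (rule submodule.m_closed[OF N]) (use 1 2 xy(1,2) in blast)+
  qed
  moreover have "P.span ?G \<subseteq> carrier P" using submodule.subset[OF N] .
  ultimately show ?thesis
    unfolding P.fin_dim_def using A(1) B(1) G by (intro exI[of _ ?G]) auto
qed

section \<open>Linear maps out of the pushout\<close>

context
  fixes T :: "('k, 't) module" and u :: "'x \<Rightarrow> 't" and v :: "'y \<Rightarrow> 't"
  assumes u: "linear_map K X T u" and v: "linear_map K Y T v"
    and uv: "\<And>w. w \<in> carrier W \<Longrightarrow> u (g w) = v (h w)"
begin

text \<open>Two representatives of a class differ by a pair (g w, - h w), and the contributions of
  its two components cancel because \<open>u (g w) = v (h w)\<close>.\<close>

lemma lift_q: "lift T u v (q (x, y)) = u x \<oplus>\<^bsub>T\<^esub> v y" if xy: "x \<in> carrier X" "y \<in> carrier Y"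
proof -
  interpret T: vectorspace K T using linear_mapD(2)[OF u] .
  note u' = linear_mapD(3-5)[OF u] and v' = linear_mapD(3-5)[OF v]
  define p where "p = inv_into (carrier X \<times> carrier Y) q (q (x, y))"
  have mem: "p \<in> carrier X \<times> carrier Y" and "q p = q (x, y)"
    using xy unfolding p_def by (auto intro!: inv_into_into f_inv_into_f imageI)
  then obtain w where w: "w \<in> carrier W" "x = fst p \<oplus>\<^bsub>X\<^esub> g w" "snd p = y \<oplus>\<^bsub>Y\<^esub> h w"
    using xy pushout_class_eq_iff[of "fst p" x "snd p" y] by auto
  have "u x \<oplus>\<^bsub>T\<^esub> v y = u (fst p) \<oplus>\<^bsub>T\<^esub> v (h w) \<oplus>\<^bsub>T\<^esub> v y"
    using w mem uv[OF w(1)] by (auto simp: u' g_simps)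
  also have "\<dots> = u (fst p) \<oplus>\<^bsub>T\<^esub> v (snd p)"
    using w mem xy by (auto simp: u' v' h_simps T.a_ac)
  finally show ?thesis
    by (simp add: pushout_lift_def Let_def p_def)
qed

lemma lift_in1: "lift T u v (in1 x) = u x" if "x \<in> carrier X"
proof -
  interpret V: linear_map K Y T v by (rule v)
  show ?thesis using that linear_mapD(3)[OF u] by (simp add: lift_q pushout_in1_def)
qed

lemma lift_in2: "lift T u v (in2 y) = v y" if "y \<in> carrier Y"
proof -
  interpret U: linear_map K X T u by (rule u)
  show ?thesis using that linear_mapD(3)[OF v] by (simp add: lift_q pushout_in2_def)
qed

lemma lift_linear: "linear_map K P T (lift T u v)"
proof (rule linear_mapI)
  interpret T: vectorspace K T using linear_mapD(2)[OF u] .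
  note u' = linear_mapD(3-5)[OF u] and v' = linear_mapD(3-5)[OF v]
  note q' = linear_mapD(3-5)[OF q_linear, unfolded direct_sum_simps]
  show "vectorspace K P" by (rule vs_pushout)
  show "vectorspace K T" by unfold_locales
  fix p assume "p \<in> carrier P"
  then obtain x y where p: "p = q (x, y)" and xy: "x \<in> carrier X" "y \<in> carrier Y"
    by (auto simp: carrier_pushout)
  show "lift T u v p \<in> carrier T"
    using xy by (simp add: p lift_q u' v')
  show "lift T u v (r \<odot>\<^bsub>P\<^esub> p) = r \<odot>\<^bsub>T\<^esub> lift T u v p" if r: "r \<in> carrier K" for r
  proof -
    have "r \<odot>\<^bsub>P\<^esub> p = q (r \<odot>\<^bsub>X\<^esub> x, r \<odot>\<^bsub>Y\<^esub> y)"
      using q'(3)[of r "(x, y)"] r xy by (simp add: p)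
    then show ?thesis
      using r xy by (simp add: p lift_q u' v' T.smult_r_distr)
  qed
  fix p' assume "p' \<in> carrier P"
  then obtain x' y' where p': "p' = q (x', y')" and xy': "x' \<in> carrier X" "y' \<in> carrier Y"
    by (auto simp: carrier_pushout)
  have "p \<oplus>\<^bsub>P\<^esub> p' = q (x \<oplus>\<^bsub>X\<^esub> x', y \<oplus>\<^bsub>Y\<^esub> y')"
    using q'(2)[of "(x, y)" "(x', y')"] xy xy' by (simp add: p p')
  then show "lift T u v (p \<oplus>\<^bsub>P\<^esub> p') = lift T u v p \<oplus>\<^bsub>T\<^esub> lift T u v p'"
    using xy xy' by (simp add: p p' lift_q u' v' T.a_ac)
qed

end

end

section \<open>Parametrized vector spaces and tameness\<close>

lemma parametrized_vectorspaceD: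
  assumes "parametrized_vectorspace K V" "0 \<le> a"
  shows "vectorspace K (space_at V a)"
    and "a \<le> b \<Longrightarrow> linear_map K (space_at V a) (space_at V b) (transition V a b)"
    and "x \<in> carrier (space_at V a) \<Longrightarrow> transition V a a x = x"
    and "\<lbrakk>a \<le> b; b \<le> c; x \<in> carrier (space_at V a)\<rbrakk> \<Longrightarrow>
      transition V b c (transition V a b x) = transition V a c x"
    and "\<lbrakk>a \<le> b; x \<in> carrier (space_at V a)\<rbrakk> \<Longrightarrow>
      transition V a b x \<in> carrier (space_at V b)"
  using assms linear_mapD(3)[of K "space_at V a" "space_at V b" "transition V a b" x]
  by (simp_all add: parametrized_vectorspace_def)

lemma natural_mapD:
  assumes "natural_map K V W f" "0 \<le> a"
  shows "linear_map K (space_at V a) (space_at W a) (f a)"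
    and "\<lbrakk>a \<le> b; x \<in> carrier (space_at V a)\<rbrakk> \<Longrightarrow>
      f b (transition V a b x) = transition W a b (f a x)"
    and "x \<in> carrier (space_at V a) \<Longrightarrow> f a x \<in> carrier (space_at W a)"
  using assms linear_mapD(3)[of K "space_at V a" "space_at W a" "f a" x]
  by (simp_all add: natural_map_def)

text \<open>\<open>Tame\<close> is stated with an increasing sequence. More critical parameters only
  weaken its requirement, so a sequence that covers \<open>S\<close> suffices.\<close>

lemma finite_pos_set_strict_mono:
  fixes S :: "real set"
  assumes "finite S" "\<And>s. s \<in> S \<Longrightarrow> 0 < s"
  obtains k :: nat and t where "0 < t 0" "strict_mono_on {..k} t" "S \<subseteq> t ` {..k}"
proof -
  \<comment> \<open>The sequence must have a first term; inserting 1 provides one when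
    \<open>S\<close> is empty and keeps all entries positive.\<close>
  define l where "l = sorted_list_of_set (insert 1 S)"
  have l: "set l = insert 1 S" "sorted_wrt (<) l"
    using assms(1) by (simp_all add: l_def del: sorted_list_of_set_insert_remove)
  then have "l \<noteq> []" by auto
  have "strict_mono_on {..length l - 1} ((!) l)"
    using sorted_wrt_nth_less[OF l(2)] \<open>l \<noteq> []\<close>
    by (auto simp: strict_mono_on_def less_Suc_eq_le[symmetric])
  moreover have "l ! 0 \<in> set l" using \<open>l \<noteq> []\<close> by simp
  then have "0 < l ! 0" using l(1) assms(2) by auto
  moreover have "S \<subseteq> (!) l ` {..length l - 1}"
  proof
    fix s assume "s \<in> S"
    then obtain i where "i < length l" "l ! i = s"
      using l(1) by (metis in_set_conv_nth insertCI)
    then show "s \<in> (!) l ` {..length l - 1}" by auto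
  qed
  ultimately show thesis using that by blast
qed

text \<open>Replaces the increasing sequence by a finite set, so that the critical sets of several
  objects can simply be united. The last premise of \<open>bij\<close> says that no element of
  \<open>S\<close> lies in the half-open interval (a, b].\<close>

lemma TameI:
  assumes V: "parametrized_vectorspace K V"
    and fd: "\<And>a. 0 \<le> a \<Longrightarrow> vectorspace.fin_dim K (space_at V a)"
    and S: "finite S" "\<And>s. s \<in> S \<Longrightarrow> 0 < s"
    and bij: "\<And>a b. \<lbrakk>0 \<le> a; a \<le> b; \<And>s. s \<in> S \<Longrightarrow> a < s \<Longrightarrow> b < s\<rbrakk> \<Longrightarrow>
      bij_betw (transition V a b) (carrier (space_at V a)) (carrier (space_at V b))"
  shows "V \<in> Tame K"
proof -
  obtain k :: nat and t where t: "0 < t 0" "strict_mono_on {..k} t" "S \<subseteq> t ` {..k}"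
    using finite_pos_set_strict_mono[OF S] by blast
  have "\<exists>i\<le>k. a < t i \<and> t i \<le> b" if ab: "0 \<le> a" "a \<le> b"
    and nb: "\<not> bij_betw (transition V a b) (carrier (space_at V a)) (carrier (space_at V b))" for a b
  proof -
    obtain s where "s \<in> S" "a < s" "s \<le> b"
      using bij[OF ab] nb by (meson not_less)
    with t(3) show ?thesis by auto
  qed
  with V fd t(1,2) show ?thesis
    unfolding Tame_def by blast
qed

lemma TameE:
  assumes "V \<in> Tame K"
  obtains S where "finite S" "\<And>s. s \<in> S \<Longrightarrow> 0 < s"
    "\<And>a b. \<lbrakk>0 \<le> a; a \<le> b; \<And>s. s \<in> S \<Longrightarrow> a < s \<Longrightarrow> b < s\<rbrakk> \<Longrightarrow>
      bij_betw (transition V a b) (carrier (space_at V a)) (carrier (space_at V b))"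
proof -
  obtain k :: nat and t where t: "0 < t 0" "strict_mono_on {..k} t"
    "\<forall>a b. 0 \<le> a \<and> a \<le> b \<and>
       \<not> bij_betw (transition V a b) (carrier (space_at V a)) (carrier (space_at V b)) \<longrightarrow>
       (\<exists>i\<le>k. a < t i \<and> t i \<le> b)"
    using assms unfolding Tame_def by blast
  show thesis
  proof (rule that[of "t ` {..k}"])
    show "0 < s" if s: "s \<in> t ` {..k}" for s
    proof -
      obtain i where i: "i \<le> k" "s = t i" using s by auto
      have "t 0 \<le> t i"
        using strict_mono_onD[OF t(2), of 0 i] i by (cases "i = 0") auto
      with t(1) i show ?thesis by simp
    qed
    show "bij_betw (transition V a b) (carrier (space_at V a)) (carrier (space_at V b))"
      if "0 \<le> a" "a \<le> b" "\<And>s. s \<in> t ` {..k} \<Longrightarrow> a < s \<Longrightarrow> b < s" for a b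
    proof (rule ccontr)
      assume "\<not> ?thesis"
      with t(3) that(1,2) obtain i where "i \<le> k" "a < t i" "t i \<le> b" by blast
      with that(3)[of "t i"] show False by auto
    qed
  qed simp
qed

section \<open>Pushouts of parametrized vector spaces\<close>

text \<open>Colimits of functors are formed pointwise. The transitions are induced, through the
  universal property at \<open>a\<close>, by those of \<open>X\<close> and \<open>Y\<close> followed
  by the coprojections at \<open>b\<close>.\<close>

definition pushout_parametrized ::
    "('k, 'w) parametrized \<Rightarrow> ('k, 'x) parametrized \<Rightarrow> ('k, 'y) parametrized \<Rightarrow>
     (real \<Rightarrow> 'w \<Rightarrow> 'x) \<Rightarrow> (real \<Rightarrow> 'w \<Rightarrow> 'y) \<Rightarrow> ('k, ('x \<times> 'y) set) parametrized" where
  "pushout_parametrized W X Y g h =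
     (let P = (\<lambda>a. pushout_vs (space_at W a) (space_at X a) (space_at Y a) (g a) (h a));
          i1 = (\<lambda>a. pushout_in1 (space_at W a) (space_at X a) (space_at Y a) (g a) (h a));
          i2 = (\<lambda>a. pushout_in2 (space_at W a) (space_at X a) (space_at Y a) (g a) (h a))
      in \<lparr>space_at = P,
          transition = (\<lambda>a b. pushout_lift (space_at W a) (space_at X a) (space_at Y a) (g a) (h a)
            (P b) (i1 b \<circ> transition X a b) (i2 b \<circ> transition Y a b))\<rparr>)"

locale parametrized_span =
  fixes K :: "('k, 'm) ring_scheme" and W :: "('k, 'w) parametrized"
    and X :: "('k, 'x) parametrized" and Y :: "('k, 'y) parametrized"
    and g :: "real \<Rightarrow> 'w \<Rightarrow> 'x" and h :: "real \<Rightarrow> 'w \<Rightarrow> 'y"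
  assumes W: "parametrized_vectorspace K W" and X: "parametrized_vectorspace K X"
    and Y: "parametrized_vectorspace K Y"
    and g: "natural_map K W X g" and h: "natural_map K W Y h"
begin

abbreviation "P \<equiv> pushout_parametrized W X Y g h"
abbreviation "q a \<equiv> pushout_class (space_at W a) (space_at X a) (space_at Y a) (g a) (h a)"
abbreviation "in1 a \<equiv> pushout_in1 (space_at W a) (space_at X a) (space_at Y a) (g a) (h a)"
abbreviation "in2 a \<equiv> pushout_in2 (space_at W a) (space_at X a) (space_at Y a) (g a) (h a)"
abbreviation "lift a \<equiv> pushout_lift (space_at W a) (space_at X a) (space_at Y a) (g a) (h a)"

lemma space_at_pushout:
  "space_at P a = pushout_vs (space_at W a) (space_at X a) (space_at Y a) (g a) (h a)"
  by (simp add: pushout_parametrized_def Let_def)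

lemma linear_span_at: "linear_span K (space_at W a) (space_at X a) (space_at Y a) (g a) (h a)"
  if "0 \<le> a"
  using that parametrized_vectorspaceD(1)[OF W] parametrized_vectorspaceD(1)[OF X]
    parametrized_vectorspaceD(1)[OF Y] natural_mapD(1)[OF g] natural_mapD(1)[OF h]
  by (simp add: linear_span_def linear_span_axioms_def)

lemmas vs_at = linear_span.vs_pushout[OF linear_span_at, folded space_at_pushout]
  and in1_linear = linear_span.in1_linear[OF linear_span_at, folded space_at_pushout]
  and in2_linear = linear_span.in2_linear[OF linear_span_at, folded space_at_pushout]
  and in1_g_eq_in2_h = linear_span.in1_g_eq_in2_h[OF linear_span_at]
  and carrier_at = linear_span.carrier_pushout[OF linear_span_at, folded space_at_pushout]
  and class_eq_iff = linear_span.pushout_class_eq_iff[OF linear_span_at]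
  and q_eq_sum = linear_span.q_eq_sum[OF linear_span_at, folded space_at_pushout]
  and hom_eqI = linear_span.pushout_hom_eqI[OF linear_span_at, folded space_at_pushout]
  and fin_dim_at = linear_span.fin_dim_pushout[OF linear_span_at, folded space_at_pushout]
  and lift_in1 = linear_span.lift_in1[OF linear_span_at]
  and lift_in2 = linear_span.lift_in2[OF linear_span_at]
  and lift_linear = linear_span.lift_linear[OF linear_span_at, folded space_at_pushout]

lemma transition_eq_lift: "transition P a b =
    lift a (space_at P b) (in1 b \<circ> transition X a b) (in2 b \<circ> transition Y a b)"
  by (simp add: pushout_parametrized_def Let_def)

context
  fixes a b :: real
  assumes ab: "0 \<le> a" "a \<le> b"
begin

lemma in1_X_linear: "linear_map K (space_at X a) (space_at P b) (in1 b \<circ> transition X a b)"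
  using linear_map_comp[OF parametrized_vectorspaceD(2)[OF X] in1_linear] ab by simp

lemma in2_Y_linear: "linear_map K (space_at Y a) (space_at P b) (in2 b \<circ> transition Y a b)"
  using linear_map_comp[OF parametrized_vectorspaceD(2)[OF Y] in2_linear] ab by simp

text \<open>The cocone condition that makes the transition well defined on classes: by naturality of
  \<open>g\<close> and \<open>h\<close> both sides come from the element
  \<open>transition W a b w\<close> at \<open>b\<close>.\<close>

lemma in1_X_in2_Y:
  assumes "w \<in> carrier (space_at W a)"
  shows "(in1 b \<circ> transition X a b) (g a w) = (in2 b \<circ> transition Y a b) (h a w)"
  using assms ab in1_g_eq_in2_h[of b "transition W a b w"]
  by (simp add: natural_mapD(2)[OF g] natural_mapD(2)[OF h] parametrized_vectorspaceD(5)[OF W])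

lemma transition_linear: "linear_map K (space_at P a) (space_at P b) (transition P a b)"
  unfolding transition_eq_lift
  by (rule lift_linear[OF ab(1) in1_X_linear in2_Y_linear in1_X_in2_Y])

lemma transition_in1: "transition P a b (in1 a x) = in1 b (transition X a b x)"
  if "x \<in> carrier (space_at X a)"
proof -
  have "transition P a b (in1 a x) = (in1 b \<circ> transition X a b) x"
    unfolding transition_eq_lift
    by (rule lift_in1[OF ab(1) in1_X_linear in2_Y_linear in1_X_in2_Y that])
  then show ?thesis by simp
qed

lemma transition_in2: "transition P a b (in2 a y) = in2 b (transition Y a b y)"
  if "y \<in> carrier (space_at Y a)"
proof -
  have "transition P a b (in2 a y) = (in2 b \<circ> transition Y a b) y"
    unfolding transition_eq_lift
    by (rule lift_in2[OF ab(1) in1_X_linear in2_Y_linear in1_X_in2_Y that])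
  then show ?thesis by simp
qed

text \<open>Lets functoriality and bijectivity of the transitions be checked on
  representatives.\<close>

lemma transition_q: "transition P a b (q a (x, y)) = q b (transition X a b x, transition Y a b y)"
  if "x \<in> carrier (space_at X a)" "y \<in> carrier (space_at Y a)"
proof -
  have "in1 a x \<in> carrier (space_at P a)" "in2 a y \<in> carrier (space_at P a)"
    using linear_mapD(3)[OF in1_linear] linear_mapD(3)[OF in2_linear] ab that by auto
  then have "transition P a b (q a (x, y)) =
      in1 b (transition X a b x) \<oplus>\<^bsub>space_at P b\<^esub> in2 b (transition Y a b y)"
    using ab that
    by (simp add: q_eq_sum linear_mapD(4)[OF transition_linear] transition_in1 transition_in2)
  also have "\<dots> = q b (transition X a b x, transition Y a b y)"
    using ab that
    by (simp add: q_eq_sum parametrized_vectorspaceD(5)[OF X] parametrized_vectorspaceD(5)[OF Y])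
  finally show ?thesis .
qed

text \<open>An isomorphism of spans induces one of pushouts. With elements: a witness in
  \<open>W\<close> for an equality of classes at \<open>b\<close> is pulled back to \<open>a\<close>
  and witnesses equality there; representatives at \<open>b\<close> are pulled back
  componentwise.\<close>

lemma transition_bij:
  assumes bW: "bij_betw (transition W a b) (carrier (space_at W a)) (carrier (space_at W b))"
    and bX: "bij_betw (transition X a b) (carrier (space_at X a)) (carrier (space_at X b))"
    and bY: "bij_betw (transition Y a b) (carrier (space_at Y a)) (carrier (space_at Y b))"
  shows "bij_betw (transition P a b) (carrier (space_at P a)) (carrier (space_at P b))"
proof (rule bij_betw_imageI)
  have b: "0 \<le> b" using ab by simp
  note X_closed = parametrized_vectorspaceD(5)[OF X ab]
    and Y_closed = parametrized_vectorspaceD(5)[OF Y ab]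
  show "inj_on (transition P a b) (carrier (space_at P a))"
  proof (rule inj_onI)
    fix p p'
    assume "p \<in> carrier (space_at P a)" "p' \<in> carrier (space_at P a)"
    then obtain x y x' y' where p: "p = q a (x, y)" "p' = q a (x', y')"
      and xy: "x \<in> carrier (space_at X a)" "x' \<in> carrier (space_at X a)"
        "y \<in> carrier (space_at Y a)" "y' \<in> carrier (space_at Y a)"
      by (auto simp: carrier_at[OF ab(1)])
    assume "transition P a b p = transition P a b p'"
    then obtain w' where w': "w' \<in> carrier (space_at W b)"
      "transition X a b x' = transition X a b x \<oplus>\<^bsub>space_at X b\<^esub> g b w'"
      "transition Y a b y = transition Y a b y' \<oplus>\<^bsub>space_at Y b\<^esub> h b w'"
      using xy by (auto simp: p transition_q class_eq_iff[OF b] X_closed Y_closed)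
    obtain w where w: "w \<in> carrier (space_at W a)" "w' = transition W a b w"
      using w'(1) bW by (auto simp: bij_betw_def)
    interpret A: linear_span K "space_at W a" "space_at X a" "space_at Y a" "g a" "h a"
      using linear_span_at[OF ab(1)] .
    have gh: "g a w \<in> carrier (space_at X a)" "h a w \<in> carrier (space_at Y a)"
      using w(1) by (simp_all add: A.g_simps(1) A.h_simps(1))
    \<comment> \<open>Both equations at \<open>b\<close> become equations between transported
      elements, and injectivity on \<open>X\<close> and \<open>Y\<close> then strips off the
      transitions.\<close>
    have "transition X a b x' = transition X a b (x \<oplus>\<^bsub>space_at X a\<^esub> g a w)"
      "transition Y a b y = transition Y a b (y' \<oplus>\<^bsub>space_at Y a\<^esub> h a w)"
      using w w' xy gh
      by (simp_all add: natural_mapD(2)[OF g ab] natural_mapD(2)[OF h ab]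
          linear_mapD(4)[OF parametrized_vectorspaceD(2)[OF X ab]]
          linear_mapD(4)[OF parametrized_vectorspaceD(2)[OF Y ab]])
    then have "x' = x \<oplus>\<^bsub>space_at X a\<^esub> g a w" "y = y' \<oplus>\<^bsub>space_at Y a\<^esub> h a w"
      using xy gh bX bY by (auto simp: bij_betw_def dest: inj_onD)
    then show "p = p'"
      unfolding p using A.pushout_class_eqI xy w(1) by blast
  qed
  show "transition P a b ` carrier (space_at P a) = carrier (space_at P b)"
  proof
    show "transition P a b ` carrier (space_at P a) \<subseteq> carrier (space_at P b)"
      using linear_mapD(3)[OF transition_linear] by blast
    show "carrier (space_at P b) \<subseteq> transition P a b ` carrier (space_at P a)"
    proof
      fix p assume "p \<in> carrier (space_at P b)"
      then obtain x' y' where p: "p = q b (x', y')" "x' \<in> carrier (space_at X b)"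
          "y' \<in> carrier (space_at Y b)"
        by (auto simp: carrier_at[OF b])
      then obtain x y where xy: "x' = transition X a b x" "y' = transition Y a b y"
        "x \<in> carrier (space_at X a)" "y \<in> carrier (space_at Y a)"
        using bX bY unfolding bij_betw_def by blast
      then have "p = transition P a b (q a (x, y))"
        by (simp add: p transition_q)
      moreover have "q a (x, y) \<in> carrier (space_at P a)"
        using xy by (auto simp: carrier_at[OF ab(1)])
      ultimately show "p \<in> transition P a b ` carrier (space_at P a)" by blast
    qed
  qed
qed

end

lemma parametrized_pushout: "parametrized_vectorspace K P"
  unfolding parametrized_vectorspace_def
proof (intro conjI allI impI ballI; (elim conjE)?)
  show "vectorspace K (space_at P a)" if "0 \<le> a" for a
    using vs_at[OF that] .
  show "linear_map K (space_at P a) (space_at P b) (transition P a b)" if "0 \<le> a" "a \<le> b" for a b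
    using transition_linear[OF that] .
  show "transition P a a p = p" if "0 \<le> a" "p \<in> carrier (space_at P a)" for a p
    using that
    by (auto simp: carrier_at transition_q parametrized_vectorspaceD(3)[OF X]
        parametrized_vectorspaceD(3)[OF Y])
  show "transition P b c (transition P a b p) = transition P a c p"
    if "p \<in> carrier (space_at P a)" "0 \<le> a" "a \<le> b" "b \<le> c" for a b c p
    using that
    by (auto simp: carrier_at transition_q parametrized_vectorspaceD(4,5)[OF X]
        parametrized_vectorspaceD(4,5)[OF Y])
qed

text \<open>On an interval that avoids the critical parameters of all three objects their
  transitions are bijective, hence so is the induced one.\<close>

lemma Tame_pushout:
  assumes "W \<in> Tame K" "X \<in> Tame K" "Y \<in> Tame K"
  shows "P \<in> Tame K"
proof -
  obtain SW where SW: "finite SW" "\<And>s. s \<in> SW \<Longrightarrow> 0 < s"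
    "\<And>a b. \<lbrakk>0 \<le> a; a \<le> b; \<And>s. s \<in> SW \<Longrightarrow> a < s \<Longrightarrow> b < s\<rbrakk> \<Longrightarrow>
      bij_betw (transition W a b) (carrier (space_at W a)) (carrier (space_at W b))"
    using TameE[OF assms(1)] by blast
  obtain SX where SX: "finite SX" "\<And>s. s \<in> SX \<Longrightarrow> 0 < s"
    "\<And>a b. \<lbrakk>0 \<le> a; a \<le> b; \<And>s. s \<in> SX \<Longrightarrow> a < s \<Longrightarrow> b < s\<rbrakk> \<Longrightarrow>
      bij_betw (transition X a b) (carrier (space_at X a)) (carrier (space_at X b))"
    using TameE[OF assms(2)] by blast
  obtain SY where SY: "finite SY" "\<And>s. s \<in> SY \<Longrightarrow> 0 < s"
    "\<And>a b. \<lbrakk>0 \<le> a; a \<le> b; \<And>s. s \<in> SY \<Longrightarrow> a < s \<Longrightarrow> b < s\<rbrakk> \<Longrightarrow>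
      bij_betw (transition Y a b) (carrier (space_at Y a)) (carrier (space_at Y b))"
    using TameE[OF assms(3)] by blast
  show ?thesis
  proof (rule TameI)
    show "finite (SW \<union> SX \<union> SY)" using SW SX SY by simp
    show "vectorspace.fin_dim K (space_at P a)" if "0 \<le> a" for a
      using fin_dim_at[OF that] assms(2,3) that by (simp add: Tame_def)
    show "bij_betw (transition P a b) (carrier (space_at P a)) (carrier (space_at P b))"
      if "0 \<le> a" "a \<le> b" "\<And>s. s \<in> SW \<union> SX \<union> SY \<Longrightarrow> a < s \<Longrightarrow> b < s" for a b
      using that by (intro transition_bij SW(3) SX(3) SY(3)) auto
  qed (use SW(2) SX(2) SY(2) parametrized_pushout in auto)
qed

section \<open>Cobase change of \<epsilon>-equivalences\<close>

lemma natural_in1: "natural_map K X P in1"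
  unfolding natural_map_def using in1_linear transition_in1 by auto

lemma natural_in2: "natural_map K Y P in2"
  unfolding natural_map_def using in2_linear transition_in2 by auto

text \<open>Only levelwise data is involved here: the linear maps \<open>\<beta>\<close> in an $\epsilon$-equivalence are
  not required to be natural, so each of them is extended to the pushout separately.\<close>

lemma eps_equivalence_in2:
  assumes eps: "eps_equivalence K C \<epsilon> W X g" and le: "\<And>a. a \<le> C a \<epsilon>"
  shows "eps_equivalence K C \<epsilon> Y P in2"
  unfolding eps_equivalence_def Let_def
proof (intro conjI allI impI natural_in2)
  fix a :: real assume a: "0 \<le> a" "C (ennreal a) \<epsilon> < \<infinity>"
  define c where "c = enn2real (C (ennreal a) \<epsilon>)"
  \<comment> \<open>Finiteness of the contour value lets the inequality pass to the real number
    \<open>c\<close>, since \<open>enn2real\<close> sends infinity to 0.\<close>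
  have c: "0 \<le> c" "a \<le> c"
    using a enn2real_mono[OF le[of "ennreal a"]] by (simp_all add: c_def)
  obtain \<beta> where \<beta>: "linear_map K (space_at X a) (space_at W c) \<beta>"
    "\<And>x. x \<in> carrier (space_at W a) \<Longrightarrow> \<beta> (g a x) = transition W a c x"
    "\<And>y. y \<in> carrier (space_at X a) \<Longrightarrow> g c (\<beta> y) = transition X a c y"
    using eps a unfolding eps_equivalence_def c_def Let_def by blast
  \<comment> \<open>On the image of \<open>Y\<close> the required map has to be the transition; on
    \<open>X\<close> one goes back to \<open>W\<close> by \<open>\<beta>\<close> and then along
    \<open>h\<close>. The two agree on \<open>W\<close> by naturality of \<open>h\<close>.\<close>
  have u: "linear_map K (space_at X a) (space_at Y c) (h c \<circ> \<beta>)"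
    using linear_map_comp[OF \<beta>(1) natural_mapD(1)[OF h c(1)]] .
  have v: "linear_map K (space_at Y a) (space_at Y c) (transition Y a c)"
    using parametrized_vectorspaceD(2)[OF Y a(1) c(2)] .
  have uv: "(h c \<circ> \<beta>) (g a w) = transition Y a c (h a w)" if "w \<in> carrier (space_at W a)" for w
    using that natural_mapD(2)[OF h a(1) c(2)] by (simp add: \<beta>(2))
  let ?l = "lift a (space_at Y c) (h c \<circ> \<beta>) (transition Y a c)"
  note l = lift_linear[OF a(1) u v uv]
  have "in2 c (?l p) = transition P a c p" if p: "p \<in> carrier (space_at P a)" for p
  proof -
    have "(in2 c \<circ> ?l) p = transition P a c p"
    proof (rule hom_eqI[OF a(1) linear_map_comp[OF l in2_linear[OF c(1)]]
          transition_linear[OF a(1) c(2)] _ _ p])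
      fix x assume x: "x \<in> carrier (space_at X a)"
      \<comment> \<open>The pushout relation at \<open>c\<close> leads from the \<open>Y\<close>
        side back to the \<open>X\<close> side, where the second equation for \<open>\<beta>\<close>
        applies.\<close>
      then have "(in2 c \<circ> ?l) (in1 a x) = in1 c (g c (\<beta> x))"
        using lift_in1[OF a(1) u v uv] in1_g_eq_in2_h[OF c(1)] linear_mapD(3)[OF \<beta>(1)]
        by (simp add: comp_def)
      then show "(in2 c \<circ> ?l) (in1 a x) = transition P a c (in1 a x)"
        using x by (simp add: \<beta>(3) transition_in1[OF a(1) c(2)])
    next
      fix y assume y: "y \<in> carrier (space_at Y a)"
      then show "(in2 c \<circ> ?l) (in2 a y) = transition P a c (in2 a y)"
        using lift_in2[OF a(1) u v uv] by (simp add: comp_def transition_in2[OF a(1) c(2)])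
    qed
    then show ?thesis by simp
  qed
  with l lift_in2[OF a(1) u v uv]
  show "\<exists>\<beta>. linear_map K (space_at P a) (space_at Y (enn2real (C (ennreal a) \<epsilon>))) \<beta> \<and>
      (\<forall>x\<in>carrier (space_at Y a).
         \<beta> (in2 a x) = transition Y a (enn2real (C (ennreal a) \<epsilon>)) x) \<and>
      (\<forall>y\<in>carrier (space_at P a). in2 (enn2real (C (ennreal a) \<epsilon>)) (\<beta> y) =
         transition P a (enn2real (C (ennreal a) \<epsilon>)) y)"
    unfolding c_def[symmetric] by blast
qed

text \<open>The mirror image of \<open>eps_equivalence_in2\<close>: now \<open>h\<close> is the
  equivalence and is pushed forward along \<open>g\<close>. The ordered pairs in
  \<open>pushout_class\<close> treat \<open>X\<close> and \<open>Y\<close> differently, so the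
  construction is repeated with the roles exchanged.\<close>

lemma eps_equivalence_in1:
  assumes eps: "eps_equivalence K C \<epsilon> W Y h" and le: "\<And>a. a \<le> C a \<epsilon>"
  shows "eps_equivalence K C \<epsilon> X P in1"
  unfolding eps_equivalence_def Let_def
proof (intro conjI allI impI natural_in1)
  fix a :: real assume a: "0 \<le> a" "C (ennreal a) \<epsilon> < \<infinity>"
  define c where "c = enn2real (C (ennreal a) \<epsilon>)"
  have c: "0 \<le> c" "a \<le> c"
    using a enn2real_mono[OF le[of "ennreal a"]] by (simp_all add: c_def)
  obtain \<beta> where \<beta>: "linear_map K (space_at Y a) (space_at W c) \<beta>"
    "\<And>x. x \<in> carrier (space_at W a) \<Longrightarrow> \<beta> (h a x) = transition W a c x"
    "\<And>y. y \<in> carrier (space_at Y a) \<Longrightarrow> h c (\<beta> y) = transition Y a c y"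
    using eps a unfolding eps_equivalence_def c_def Let_def by blast
  have u: "linear_map K (space_at X a) (space_at X c) (transition X a c)"
    using parametrized_vectorspaceD(2)[OF X a(1) c(2)] .
  have v: "linear_map K (space_at Y a) (space_at X c) (g c \<circ> \<beta>)"
    using linear_map_comp[OF \<beta>(1) natural_mapD(1)[OF g c(1)]] .
  have uv: "transition X a c (g a w) = (g c \<circ> \<beta>) (h a w)" if "w \<in> carrier (space_at W a)" for w
    using that natural_mapD(2)[OF g a(1) c(2)] by (simp add: \<beta>(2))
  let ?l = "lift a (space_at X c) (transition X a c) (g c \<circ> \<beta>)"
  note l = lift_linear[OF a(1) u v uv]
  have "in1 c (?l p) = transition P a c p" if p: "p \<in> carrier (space_at P a)" for p
  proof -
    have "(in1 c \<circ> ?l) p = transition P a c p"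
    proof (rule hom_eqI[OF a(1) linear_map_comp[OF l in1_linear[OF c(1)]]
          transition_linear[OF a(1) c(2)] _ _ p])
      fix x assume x: "x \<in> carrier (space_at X a)"
      then show "(in1 c \<circ> ?l) (in1 a x) = transition P a c (in1 a x)"
        using lift_in1[OF a(1) u v uv] by (simp add: comp_def transition_in1[OF a(1) c(2)])
    next
      fix y assume y: "y \<in> carrier (space_at Y a)"
      then have "(in1 c \<circ> ?l) (in2 a y) = in2 c (h c (\<beta> y))"
        using lift_in2[OF a(1) u v uv] in1_g_eq_in2_h[OF c(1)] linear_mapD(3)[OF \<beta>(1)]
        by (simp add: comp_def)
      then show "(in1 c \<circ> ?l) (in2 a y) = transition P a c (in2 a y)"
        using y by (simp add: \<beta>(3) transition_in2[OF a(1) c(2)])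
    qed
    then show ?thesis by simp
  qed
  with l lift_in1[OF a(1) u v uv]
  show "\<exists>\<beta>. linear_map K (space_at P a) (space_at X (enn2real (C (ennreal a) \<epsilon>))) \<beta> \<and>
      (\<forall>x\<in>carrier (space_at X a).
         \<beta> (in1 a x) = transition X a (enn2real (C (ennreal a) \<epsilon>)) x) \<and>
      (\<forall>y\<in>carrier (space_at P a). in1 (enn2real (C (ennreal a) \<epsilon>)) (\<beta> y) =
         transition P a (enn2real (C (ennreal a) \<epsilon>)) y)"
    unfolding c_def[symmetric] by blast
qed

end

section \<open>Identities and composites of \<epsilon>-equivalences\<close>

lemma contourD:
  assumes "contour C" "0 \<le> \<epsilon>"
  shows "a \<le> C a \<epsilon>"
    and "\<lbrakk>0 \<le> \<tau>; \<epsilon> \<le> \<tau>\<rbrakk> \<Longrightarrow> C a \<epsilon> \<le> C a \<tau>"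
    and "0 \<le> \<tau> \<Longrightarrow> C (C a \<epsilon>) \<tau> \<le> C a (\<epsilon> + \<tau>)"
  using assms unfolding contour_def by auto

text \<open>The transition of \<open>V\<close> from \<open>a\<close> to the contour value serves as
  the backward map.\<close>

lemma eps_equivalence_id:
  assumes V: "parametrized_vectorspace K V" and le: "\<And>a. a \<le> C a \<epsilon>"
  shows "eps_equivalence K C \<epsilon> V V (\<lambda>a x. x)"
proof -
  have "linear_map K (space_at V a) (space_at V a) (\<lambda>x. x)" if "0 \<le> a" for a
    using parametrized_vectorspaceD(1)[OF V that] by (intro linear_mapI) auto
  moreover have "linear_map K (space_at V a) (space_at V (enn2real (C (ennreal a) \<epsilon>)))
      (transition V a (enn2real (C (ennreal a) \<epsilon>)))"
    if "0 \<le> a" "C (ennreal a) \<epsilon> < \<infinity>" for a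
    using that enn2real_mono[OF le[of "ennreal a"]]
    by (intro parametrized_vectorspaceD(2)[OF V]) simp_all
  ultimately show ?thesis
    unfolding eps_equivalence_def natural_map_def Let_def by auto
qed

lemma natural_map_comp:
  assumes "natural_map K V X f" "natural_map K X P f'"
  shows "natural_map K V P (\<lambda>a. f' a \<circ> f a)"
  using assms linear_map_comp natural_mapD(3)[OF assms(1)]
  unfolding natural_map_def by fastforce

text \<open>Backward maps compose in the opposite order: \<open>f'\<close> is undone first, from
  \<open>a\<close> to \<open>c1\<close>, then \<open>f\<close>, from \<open>c1\<close> to
  \<open>c2\<close>. The contour is thus applied with \<tau> before \<epsilon>, and its third axiom
  bounds \<open>c2\<close> by the value \<open>c\<close> for the sum.\<close>

lemma eps_equivalence_comp:
  assumes C: "contour C" "0 \<le> \<epsilon>" "0 \<le> \<tau>"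
    and V: "parametrized_vectorspace K V" and X: "parametrized_vectorspace K X"
    and P: "parametrized_vectorspace K P"
    and f: "eps_equivalence K C \<epsilon> V X f" and f': "eps_equivalence K C \<tau> X P f'"
  shows "eps_equivalence K C (\<epsilon> + \<tau>) V P (\<lambda>a. f' a \<circ> f a)"
proof -
  have nf: "natural_map K V X f" and nf': "natural_map K X P f'"
    using f f' by (simp_all add: eps_equivalence_def)
  show ?thesis
    unfolding eps_equivalence_def Let_def
  proof (intro conjI allI impI natural_map_comp[OF nf nf'])
    fix a :: real assume a: "0 \<le> a" "C (ennreal a) (\<epsilon> + \<tau>) < \<infinity>"
    define c where "c = enn2real (C (ennreal a) (\<epsilon> + \<tau>))"
    \<comment> \<open>Only the value at the sum is assumed finite; monotonicity makes the
      intermediate value finite too, so that \<open>f'\<close> provides a backward map at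
      \<open>a\<close>.\<close>
    have "C (ennreal a) \<tau> \<le> C (ennreal a) (\<epsilon> + \<tau>)"
      using contourD(2)[OF C(1,3)] C by simp
    then have fin1: "C (ennreal a) \<tau> < \<infinity>" using a(2) by (rule le_less_trans)
    define c1 where "c1 = enn2real (C (ennreal a) \<tau>)"
    have c1: "ennreal c1 = C (ennreal a) \<tau>" "0 \<le> c1" "a \<le> c1"
      using fin1 a enn2real_mono[OF contourD(1)[OF C(1,3), of "ennreal a"]]
      by (simp_all add: c1_def)
    have le2: "C (ennreal c1) \<epsilon> \<le> C (ennreal a) (\<epsilon> + \<tau>)"
      using contourD(3)[OF C(1,3,2)] by (simp add: c1 add.commute)
    then have fin2: "C (ennreal c1) \<epsilon> < \<infinity>" using a(2) by (rule le_less_trans)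
    define c2 where "c2 = enn2real (C (ennreal c1) \<epsilon>)"
    have "enn2real (ennreal c1) \<le> c2"
      using enn2real_mono[OF contourD(1)[OF C(1,2), of "ennreal c1"]] fin2 by (simp add: c2_def)
    moreover have "c2 \<le> c"
      using enn2real_mono[OF le2] a by (simp add: c2_def c_def)
    ultimately have c2: "0 \<le> c2" "c1 \<le> c2" "c2 \<le> c"
      using c1(2) by (simp_all add: c2_def)
    obtain \<beta>' where \<beta>': "linear_map K (space_at P a) (space_at X c1) \<beta>'"
      "\<And>x. x \<in> carrier (space_at X a) \<Longrightarrow> \<beta>' (f' a x) = transition X a c1 x"
      "\<And>y. y \<in> carrier (space_at P a) \<Longrightarrow> f' c1 (\<beta>' y) = transition P a c1 y"
      using f' a fin1 unfolding eps_equivalence_def c1_def Let_def by blast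
    obtain \<beta> where \<beta>: "linear_map K (space_at X c1) (space_at V c2) \<beta>"
      "\<And>x. x \<in> carrier (space_at V c1) \<Longrightarrow> \<beta> (f c1 x) = transition V c1 c2 x"
      "\<And>y. y \<in> carrier (space_at X c1) \<Longrightarrow> f c2 (\<beta> y) = transition X c1 c2 y"
      using f c1 fin2 unfolding eps_equivalence_def c2_def Let_def by blast
    \<comment> \<open>\<open>c2\<close> may be smaller than \<open>c\<close>; the last transition
      makes up the difference.\<close>
    let ?\<beta> = "transition V c2 c \<circ> (\<beta> \<circ> \<beta>')"
    have "linear_map K (space_at P a) (space_at V c) ?\<beta>"
      using linear_map_comp[OF linear_map_comp[OF \<beta>'(1) \<beta>(1)]
          parametrized_vectorspaceD(2)[OF V c2(1,3)]] .
    moreover have "?\<beta> ((f' a \<circ> f a) x) = transition V a c x"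
      if x: "x \<in> carrier (space_at V a)" for x
    proof -
      \<comment> \<open>Naturality puts this element into the image of \<open>f c1\<close>, where
        the first equation for \<open>\<beta>\<close> applies.\<close>
      have "\<beta>' (f' a (f a x)) = f c1 (transition V a c1 x)"
        using x a(1) c1(3) by (simp add: \<beta>'(2) natural_mapD(2,3)[OF nf])
      then show ?thesis
        using x a(1) c1(2,3) c2 by (simp add: \<beta>(2) parametrized_vectorspaceD(4,5)[OF V])
    qed
    moreover have "(f' c \<circ> f c) (?\<beta> y) = transition P a c y"
      if y: "y \<in> carrier (space_at P a)" for y
    proof -
      have b': "\<beta>' y \<in> carrier (space_at X c1)" using linear_mapD(3)[OF \<beta>'(1) y] .
      have b: "\<beta> (\<beta>' y) \<in> carrier (space_at V c2)" using linear_mapD(3)[OF \<beta>(1) b'] .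
      \<comment> \<open>\<open>f\<close> is moved past the transition of \<open>V\<close>, so that
        the second equation for \<open>\<beta>\<close> applies at \<open>c2\<close>.\<close>
      have "f c (?\<beta> y) = transition X c1 c (\<beta>' y)"
        using b b' c1(2) c2
        by (simp add: natural_mapD(2)[OF nf] \<beta>(3) parametrized_vectorspaceD(4)[OF X])
      also have "f' c \<dots> = transition P c1 c (transition P a c1 y)"
        using b' y c1(2) c2 by (simp add: natural_mapD(2)[OF nf'] \<beta>'(3))
      also have "\<dots> = transition P a c y"
        using y a(1) c1(3) c2 by (simp add: parametrized_vectorspaceD(4)[OF P])
      finally show ?thesis by simp
    qed
    ultimately show "\<exists>\<beta>. linear_map K (space_at P a)
          (space_at V (enn2real (C (ennreal a) (\<epsilon> + \<tau>)))) \<beta> \<and>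
        (\<forall>x\<in>carrier (space_at V a). \<beta> ((f' a \<circ> f a) x) =
           transition V a (enn2real (C (ennreal a) (\<epsilon> + \<tau>))) x) \<and>
        (\<forall>y\<in>carrier (space_at P a). (f' (enn2real (C (ennreal a) (\<epsilon> + \<tau>))) \<circ>
           f (enn2real (C (ennreal a) (\<epsilon> + \<tau>)))) (\<beta> y) =
           transition P a (enn2real (C (ennreal a) (\<epsilon> + \<tau>))) y)"
      unfolding c_def[symmetric] by blast
  qed
qed

section \<open>The relation of \<epsilon>-equivalence\<close>

text \<open>\<open>V\<close> itself is the intermediate object, with identities as both legs;
  \<open>eps_equivalentI\<close> takes care of its carrier type.\<close>

lemma eps_equivalent_refl:
  assumes "contour C" "V \<in> Tame K"
  shows "eps_equivalent K C 0 V V"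
proof -
  have "eps_equivalence K C 0 V V (\<lambda>a x. x)"
    using assms by (intro eps_equivalence_id contourD(1)) (auto simp: Tame_def)
  then show ?thesis
    using eps_equivalentI[OF assms, of 0 0 0] by auto
qed

lemma eps_equivalent_sym: "eps_equivalent K C \<epsilon> V W \<Longrightarrow> eps_equivalent K C \<epsilon> W V"
  unfolding eps_equivalent_def by (metis add.commute)

lemma eps_equivalent_trans:
  assumes C: "contour C" and tame: "V \<in> Tame K" "W \<in> Tame K" "Z \<in> Tame K"
    and VW: "eps_equivalent K C \<epsilon> V W" and WZ: "eps_equivalent K C \<delta> W Z"
  shows "eps_equivalent K C (\<epsilon> + \<delta>) V Z"
proof -
  obtain X :: "('a, nat \<Rightarrow> 'a) parametrized" and f g \<epsilon>1 \<epsilon>2 where X: "X \<in> Tame K"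
    and \<epsilon>: "0 \<le> \<epsilon>1" "0 \<le> \<epsilon>2" "\<epsilon>1 + \<epsilon>2 \<le> \<epsilon>"
    and f: "eps_equivalence K C \<epsilon>1 V X f" and g: "eps_equivalence K C \<epsilon>2 W X g"
    using VW unfolding eps_equivalent_def by blast
  obtain Y :: "('a, nat \<Rightarrow> 'a) parametrized" and h k \<delta>1 \<delta>2 where Y: "Y \<in> Tame K"
    and \<delta>: "0 \<le> \<delta>1" "0 \<le> \<delta>2" "\<delta>1 + \<delta>2 \<le> \<delta>"
    and h: "eps_equivalence K C \<delta>1 W Y h" and k: "eps_equivalence K C \<delta>2 Z Y k"
    using WZ unfolding eps_equivalent_def by blast
  interpret S: parametrized_span K W X Y g h
    using tame(2) X Y g h by unfold_locales (auto simp: Tame_def eps_equivalence_def)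
  have pv: "parametrized_vectorspace K V" "parametrized_vectorspace K Z"
    using tame by (auto simp: Tame_def)
  \<comment> \<open>Cobase change keeps the constant of the parallel leg: \<open>in1\<close> is a
    \<open>\<delta>1\<close>-equivalence because \<open>h\<close> is, and \<open>in2\<close> an
    \<open>\<epsilon>2\<close>-equivalence because \<open>g\<close> is.\<close>
  have 1: "eps_equivalence K C (\<epsilon>1 + \<delta>1) V S.P (\<lambda>a. S.in1 a \<circ> f a)"
    by (rule eps_equivalence_comp[OF C \<epsilon>(1) \<delta>(1) pv(1) S.X S.parametrized_pushout f
          S.eps_equivalence_in1[OF h contourD(1)[OF C \<delta>(1)]]])
  have 2: "eps_equivalence K C (\<delta>2 + \<epsilon>2) Z S.P (\<lambda>a. S.in2 a \<circ> k a)"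
    by (rule eps_equivalence_comp[OF C \<delta>(2) \<epsilon>(2) pv(2) S.Y S.parametrized_pushout k
          S.eps_equivalence_in2[OF g contourD(1)[OF C \<epsilon>(2)]]])
  \<comment> \<open>The four constants add up to at most \<epsilon> + \<delta>. The elements of the
    pushout are sets of pairs, and \<open>eps_equivalentI\<close> moves it to the prescribed carrier
    type.\<close>
  show ?thesis
    by (rule eps_equivalentI[OF C S.Tame_pushout[OF tame(2) X Y] _ _ _ 1 2]) (use \<epsilon> \<delta> in auto)
qed

section \<open>The distance\<close>

lemma contour_dist_le: "contour_dist K C V W \<le> ennreal \<epsilon>"
  if "0 \<le> \<epsilon>" "eps_equivalent K C \<epsilon> V W"
  unfolding contour_dist_def using that by (intro Inf_lower) blast

lemma contour_dist_lessE:
  assumes "contour_dist K C V W < r"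
  obtains \<epsilon> where "0 \<le> \<epsilon>" "eps_equivalent K C \<epsilon> V W" "ennreal \<epsilon> < r"
  using assms unfolding contour_dist_def by (auto simp: Inf_less_iff)

text \<open>The infima need not be attained, hence the slack \<open>e\<close>, half of which goes to
  each distance on the right. \<open>ennreal_le_epsilon\<close> also disposes of an infinite
  right-hand side.\<close>

lemma contour_dist_triangle:
  assumes C: "contour C" and tame: "V \<in> Tame K" "W \<in> Tame K" "Z \<in> Tame K"
  shows "contour_dist K C V Z \<le> contour_dist K C V W + contour_dist K C W Z"
proof (rule ennreal_le_epsilon)
  fix e :: real
  assume fin: "contour_dist K C V W + contour_dist K C W Z < top_class.top" and e: "0 < e"
  \<comment> \<open>Strictness fails at infinity, hence the restriction to finite values.\<close>
  have lt: "x < x + ennreal (e / 2)" if "x < top_class.top" for x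
    using that e by (cases x) (simp_all add: ennreal_less_iff flip: ennreal_plus)
  obtain \<epsilon> where \<epsilon>: "0 \<le> \<epsilon>" "eps_equivalent K C \<epsilon> V W"
    "ennreal \<epsilon> < contour_dist K C V W + ennreal (e / 2)"
    by (rule contour_dist_lessE[OF lt[of "contour_dist K C V W"]]) (use fin in auto)
  obtain \<delta> where \<delta>: "0 \<le> \<delta>" "eps_equivalent K C \<delta> W Z"
    "ennreal \<delta> < contour_dist K C W Z + ennreal (e / 2)"
    by (rule contour_dist_lessE[OF lt[of "contour_dist K C W Z"]]) (use fin in auto)
  have "contour_dist K C V Z \<le> ennreal (\<epsilon> + \<delta>)"
    using \<epsilon> \<delta> eps_equivalent_trans[OF C tame] by (intro contour_dist_le) auto
  also have "\<dots> \<le> (contour_dist K C V W + ennreal (e / 2)) + (contour_dist K C W Z + ennreal (e / 2))"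
    using \<epsilon> \<delta> by (simp add: ennreal_plus add_mono less_imp_le)
  also have "\<dots> = contour_dist K C V W + contour_dist K C W Z + (ennreal (e / 2) + ennreal (e / 2))"
    by (simp add: ac_simps)
  also have "ennreal (e / 2) + ennreal (e / 2) = ennreal e"
    using e by (simp flip: ennreal_plus)
  finally show "contour_dist K C V Z \<le> contour_dist K C V W + contour_dist K C W Z + ennreal e" .
qed

theorem proposition6p1:
  fixes K :: "('k, 'm) ring_scheme"
    and C :: "ennreal \<Rightarrow> real \<Rightarrow> ennreal"
  assumes "field K"
    and "contour C"
  shows "pseudometric_on (Tame K :: ('k, 'v) parametrized set) (contour_dist K C)"
  unfolding pseudometric_on_def
proof (intro conjI ballI)
  fix X Y Z :: "('k, 'v) parametrized"
  assume X: "X \<in> Tame K" and Y: "Y \<in> Tame K" and Z: "Z \<in> Tame K"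
  show "contour_dist K C X Z \<le> contour_dist K C X Y + contour_dist K C Y Z"
    using contour_dist_triangle[OF assms(2) X Y Z] .
next
  fix X :: "('k, 'v) parametrized"
  assume "X \<in> Tame K"
  \<comment> \<open>The value 0 is itself admissible in the infimum.\<close>
  then show "contour_dist K C X X = 0"
    using contour_dist_le[OF _ eps_equivalent_refl[OF assms(2)]] by fastforce
next
  fix X Y :: "('k, 'v) parametrized"
  \<comment> \<open>Both infima are thus taken over the same set.\<close>
  have "eps_equivalent K C \<epsilon> X Y \<longleftrightarrow> eps_equivalent K C \<epsilon> Y X" for \<epsilon>
    using eps_equivalent_sym by blast
  then show "contour_dist K C X Y = contour_dist K C Y X"
    by (simp add: contour_dist_def)
qed

end
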